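(* Let $L$ be a finite-dimensional Leibniz algebra over an arbitrary field $F$. Then every subalgebra of $L$ is a weak quasi-ideal of $L$ and $L/\phi(L)$ is a non-Lie almost abelian Leibniz algebra if and only if either (i) $L$ is a non-Lie almost abelian Leibniz algebra, or (ii) $L=C\dot{+}A$, where $C$ is a cyclic Leibniz algebra with basis $x,\ldots,x^k$ with $k\geq 2$ and $x^{k+1}=x^k$, $A$ is abelian (possibly $0$), $[a,x]=a$ for all $a\in A$, and all other products are zero.
   Context: A (right) Leibniz algebra over a field $F$ is a vector space $L$ with a bilinear product $[\cdot,\cdot]$ satisfying $[x,[y,z]]=[[x,y],z]-[[x,z],y]$ for all $x,y,z$. Powers are defined by $x^1=x$, $x^{i+1}=[x^i,x]$. A Leibniz algebra is cyclic if it is generated by one element, and abelian if all its products are zero. In (ii), $C$ and $A$ are subalgebras of $L$, $\dot{+}$ denotes a direct sum of vector spaces, the products $[x^i,x]=x^{i+1}$ ($1\le i\le k$, with $x^{k+1}=x^k$) and $[a,x]=a$ are the nonzero ones, and all products of basis elements not determined by these are zero. A subalgebra $U$ of $L$ is a weak quasi-ideal of $L$ if $[U,V]+[V,U]\subseteq U+V$ for every subalgebra $V$ of $L$. The Frattini ideal $\phi(L)$ is the largest ideal of $L$ contained in the intersection of all maximal subalgebras of $L$. A Leibniz algebra $M$ is a non-Lie almost abelian Leibniz algebra if $M=A'+Fy$ where $A'\neq 0$ is an abelian ideal, and $[a,y]=a$, $[y,a]=0$ for all $a\in A'$ ($y$ may be taken with $y^2=0$). *)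

theory Defs
  imports "Jordan_Normal_Form.Missing_VectorSpace" "HOL-Algebra.QuotRing"
begin

text \<open>
  The multiplication slot of the module record, which the locale \<^locale>\<open>vectorspace\<close> leaves
  unconstrained, holds the Leibniz product: \<open>x \<otimes>\<^bsub>L\<^esub> y\<close> is $[x,y]$.
  The slot for the multiplicative unit carries no meaning.
\<close>

locale leibniz_algebra = vectorspace F L
  for F :: "('f, 'r) ring_scheme" and L :: "('f, 'v, 'm) module_scheme" (structure) +
  assumes bracket_closed:
      "\<lbrakk>x \<in> carrier L; y \<in> carrier L\<rbrakk> \<Longrightarrow> x \<otimes> y \<in> carrier L"
    and bracket_add_left:
      "\<lbrakk>x \<in> carrier L; y \<in> carrier L; z \<in> carrier L\<rbrakk> \<Longrightarrow> (x \<oplus> y) \<otimes> z = x \<otimes> z \<oplus> y \<otimes> z"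
    and bracket_add_right:
      "\<lbrakk>x \<in> carrier L; y \<in> carrier L; z \<in> carrier L\<rbrakk> \<Longrightarrow> x \<otimes> (y \<oplus> z) = x \<otimes> y \<oplus> x \<otimes> z"
    and bracket_smult_left:
      "\<lbrakk>c \<in> carrier F; x \<in> carrier L; y \<in> carrier L\<rbrakk> \<Longrightarrow> (c \<odot> x) \<otimes> y = c \<odot> (x \<otimes> y)"
    and bracket_smult_right:
      "\<lbrakk>c \<in> carrier F; x \<in> carrier L; y \<in> carrier L\<rbrakk> \<Longrightarrow> x \<otimes> (c \<odot> y) = c \<odot> (x \<otimes> y)"
    and leibniz_identity:
      "\<lbrakk>x \<in> carrier L; y \<in> carrier L; z \<in> carrier L\<rbrakk>
        \<Longrightarrow> x \<otimes> (y \<otimes> z) = (x \<otimes> y) \<otimes> z \<ominus> (x \<otimes> z) \<otimes> y"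

text \<open>Only exponents \<open>n \<ge> 1\<close> are meaningful; \<open>lpow L x 0 = x\<close> is a junk value.\<close>

definition lpow :: "('f, 'v, 'm) module_scheme \<Rightarrow> 'v \<Rightarrow> nat \<Rightarrow> 'v" where
  "lpow L x n = ((\<lambda>y. y \<otimes>\<^bsub>L\<^esub> x) ^^ (n - 1)) x"

definition subalgebra ::
    "('f, 'r) ring_scheme \<Rightarrow> ('f, 'v, 'm) module_scheme \<Rightarrow> 'v set \<Rightarrow> bool" where
  "subalgebra F L U \<longleftrightarrow> subspace F U L \<and> (\<forall>u\<in>U. \<forall>v\<in>U. u \<otimes>\<^bsub>L\<^esub> v \<in> U)"

definition leibniz_ideal ::
    "('f, 'r) ring_scheme \<Rightarrow> ('f, 'v, 'm) module_scheme \<Rightarrow> 'v set \<Rightarrow> bool" where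
  "leibniz_ideal F L I \<longleftrightarrow> subspace F I L \<and>
     (\<forall>i\<in>I. \<forall>x\<in>carrier L. i \<otimes>\<^bsub>L\<^esub> x \<in> I \<and> x \<otimes>\<^bsub>L\<^esub> i \<in> I)"

definition generated_subalgebra ::
    "('f, 'r) ring_scheme \<Rightarrow> ('f, 'v, 'm) module_scheme \<Rightarrow> 'v set \<Rightarrow> 'v set" where
  "generated_subalgebra F L S = \<Inter> {U. subalgebra F L U \<and> S \<subseteq> U}"

definition abelian_subset :: "('f, 'v, 'm) module_scheme \<Rightarrow> 'v set \<Rightarrow> bool" where
  "abelian_subset L A \<longleftrightarrow> (\<forall>a\<in>A. \<forall>b\<in>A. a \<otimes>\<^bsub>L\<^esub> b = \<zero>\<^bsub>L\<^esub>)"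

definition bracket_space ::
    "('f, 'r) ring_scheme \<Rightarrow> ('f, 'v, 'm) module_scheme \<Rightarrow> 'v set \<Rightarrow> 'v set \<Rightarrow> 'v set" where
  "bracket_space F L U V = LinearCombinations.module.span F L {u \<otimes>\<^bsub>L\<^esub> v | u v. u \<in> U \<and> v \<in> V}"

definition weak_quasi_ideal ::
    "('f, 'r) ring_scheme \<Rightarrow> ('f, 'v, 'm) module_scheme \<Rightarrow> 'v set \<Rightarrow> bool" where
  "weak_quasi_ideal F L U \<longleftrightarrow> subalgebra F L U \<and>
     (\<forall>V. subalgebra F L V \<longrightarrow>
        bracket_space F L U V <+>\<^bsub>L\<^esub> bracket_space F L V U \<subseteq> U <+>\<^bsub>L\<^esub> V)"

definition maximal_subalgebra ::
    "('f, 'r) ring_scheme \<Rightarrow> ('f, 'v, 'm) module_scheme \<Rightarrow> 'v set \<Rightarrow> bool" where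
  "maximal_subalgebra F L M \<longleftrightarrow> subalgebra F L M \<and> M \<noteq> carrier L \<and>
     (\<forall>U. subalgebra F L U \<and> M \<subseteq> U \<longrightarrow> U = M \<or> U = carrier L)"

text \<open>
  Largest with respect to inclusion; existence is lemma \<open>frattini_ideal_greatest\<close> below.
  If \<open>L = 0\<close> there are no maximal subalgebras; the intersection is then everything
  and the Frattini ideal is \<open>L\<close> itself.
\<close>

definition frattini_ideal ::
    "('f, 'r) ring_scheme \<Rightarrow> ('f, 'v, 'm) module_scheme \<Rightarrow> 'v set" where
  "frattini_ideal F L =
     (GREATEST I. leibniz_ideal F L I \<and> I \<subseteq> \<Inter> {M. maximal_subalgebra F L M})"

text \<open>The analogue of \<^const>\<open>FactRing\<close>, with cosets of \<open>I\<close> as elements.\<close>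

definition quotient_algebra ::
    "('f, 'v, 'm) module_scheme \<Rightarrow> 'v set \<Rightarrow> ('f, 'v set) module" where
  "quotient_algebra L I =
     \<lparr>carrier = a_rcosets\<^bsub>L\<^esub> I, mult = rcoset_mult L I, one = I +>\<^bsub>L\<^esub> \<one>\<^bsub>L\<^esub>,
      zero = I, add = set_add L, smult = (\<lambda>c X. \<Union>x\<in>X. I +>\<^bsub>L\<^esub> (c \<odot>\<^bsub>L\<^esub> x))\<rparr>"

text \<open>
  The normalisation $y^2 = 0$ is not part of the definition, since it can always be achieved:
  see lemma \<open>nonlie_almost_abelian_iff\<close> below.
\<close>

definition nonlie_almost_abelian ::
    "('f, 'r) ring_scheme \<Rightarrow> ('f, 'v, 'm) module_scheme \<Rightarrow> bool" where
  "nonlie_almost_abelian F M \<longleftrightarrow> leibniz_algebra F M \<and>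
     (\<exists>A y. leibniz_ideal F M A \<and> A \<noteq> {\<zero>\<^bsub>M\<^esub>} \<and> abelian_subset M A \<and> y \<in> carrier M \<and>
        carrier M = A <+>\<^bsub>M\<^esub> {c \<odot>\<^bsub>M\<^esub> y | c. c \<in> carrier F} \<and>
        (\<forall>a\<in>A. a \<otimes>\<^bsub>M\<^esub> y = a \<and> y \<otimes>\<^bsub>M\<^esub> a = \<zero>\<^bsub>M\<^esub>))"


subsection \<open>The definitions are meaningful\<close>

context leibniz_algebra
begin

lemma bracket_zero_left: "x \<in> carrier L \<Longrightarrow> \<zero> \<otimes> x = \<zero>"
  using bracket_smult_left[of "\<zero>\<^bsub>F\<^esub>" "\<zero>" x] bracket_closed[of "\<zero>" x] by simp

lemma bracket_zero_right: "x \<in> carrier L \<Longrightarrow> x \<otimes> \<zero> = \<zero>"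
  using bracket_smult_right[of "\<zero>\<^bsub>F\<^esub>" x "\<zero>"] bracket_closed[of x "\<zero>"] by simp

lemma subspace_iff: "subspace F U L \<longleftrightarrow> submodule F U L"
  by (auto simp: subspace_def vectorspace_axioms)

lemma frattini_ideal_greatest:
  "leibniz_ideal F L (frattini_ideal F L)"
  "frattini_ideal F L \<subseteq> \<Inter> {M. maximal_subalgebra F L M}"
  "\<lbrakk>leibniz_ideal F L I; I \<subseteq> \<Inter> {M. maximal_subalgebra F L M}\<rbrakk> \<Longrightarrow> I \<subseteq> frattini_ideal F L"
proof -
  let ?P = "\<lambda>I. leibniz_ideal F L I \<and> I \<subseteq> \<Inter> {M. maximal_subalgebra F L M}"
  define S where "S = \<Union> {I. ?P I}"
  have Sc: "S \<subseteq> carrier L"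
    unfolding S_def leibniz_ideal_def subspace_iff using submodule.subset by blast
  have sub: "submodule F (span S) L" by (rule span_is_submodule[OF Sc])
  have spc: "span S \<subseteq> carrier L" by (rule submodule.subset[OF sub])
  have inS: "S \<subseteq> span S" by (rule in_own_span[OF Sc])
  have r: "i \<otimes> x \<in> span S" and l: "x \<otimes> i \<in> span S"
    if i: "i \<in> span S" and x: "x \<in> carrier L" for i x
  proof -
    let ?N = "{v \<in> carrier L. v \<otimes> x \<in> span S \<and> x \<otimes> v \<in> span S}"
    have "submodule F ?N L"
    proof (rule submodule.intro)
      show "module F L" by (rule module_axioms)
    qed (use x submodule.m_closed[OF sub] submodule.smult_closed[OF sub]
              submodule.zero_closed[OF sub] in
           \<open>auto simp: bracket_add_left bracket_add_right bracket_smult_left bracket_smult_right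
              bracket_zero_left bracket_zero_right\<close>)
    moreover have "S \<subseteq> ?N"
      using Sc inS x unfolding S_def leibniz_ideal_def by blast
    ultimately have "span S \<subseteq> ?N" by (intro span_is_subset)
    with i show "i \<otimes> x \<in> span S" "x \<otimes> i \<in> span S" by auto
  qed
  have max: "span S \<subseteq> M" if "maximal_subalgebra F L M" for M
    using that unfolding maximal_subalgebra_def subalgebra_def subspace_iff
    by (intro span_is_subset) (auto simp: S_def maximal_subalgebra_def subalgebra_def subspace_iff)
  have P: "?P (span S)"
    using sub r l max unfolding leibniz_ideal_def subspace_iff by blast
  have ge: "\<And>I. ?P I \<Longrightarrow> I \<subseteq> span S" using inS S_def by blast
  have eq: "frattini_ideal F L = span S"
    unfolding frattini_ideal_def by (rule Greatest_equality) (use P ge in auto)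
  show "leibniz_ideal F L (frattini_ideal F L)"
    "frattini_ideal F L \<subseteq> \<Inter> {M. maximal_subalgebra F L M}"
    using P eq by auto
  show "\<lbrakk>leibniz_ideal F L I; I \<subseteq> \<Inter> {M. maximal_subalgebra F L M}\<rbrakk> \<Longrightarrow> I \<subseteq> frattini_ideal F L"
    using ge eq by auto
qed

end

lemma (in module) submodule_abelian_subgroup:
  assumes "submodule R N M"
  shows "abelian_subgroup N M"
proof (rule abelian_subgroupI3[OF additive_subgroupI])
  interpret N: submodule R N M by fact
  show "subgroup N (add_monoid M)"
    by (rule subgroup.intro)
      (use N.subset in \<open>auto simp flip: a_inv_def simp: smult_minus_1[symmetric]\<close>)
qed (rule M.abelian_group_axioms)

context leibniz_algebra
begin

context
  fixes I
  assumes I: "leibniz_ideal F L I"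
begin

interpretation I: submodule F I L
  using I by (simp add: leibniz_ideal_def subspace_iff)

interpretation I: abelian_subgroup I L
  by (rule submodule_abelian_subgroup[OF I.submodule_axioms])

lemma coset_eqI:
  assumes "i \<in> I" "x \<in> carrier L" "y = i \<oplus> x"
  shows "I +> y = I +> x"
  using assms I.a_repr_independence'[of y x] by (auto simp: a_r_coset_def')

lemma coset_bracket:
  assumes "x \<in> carrier L" "y \<in> carrier L"
  shows "rcoset_mult L I (I +> x) (I +> y) = I +> (x \<otimes> y)"
proof -
  have "I +> (x' \<otimes> y') = I +> (x \<otimes> y)" if "x' \<in> I +> x" "y' \<in> I +> y" for x' y'
  proof -
    from that obtain i j where ij: "i \<in> I" "j \<in> I" and e: "x' = i \<oplus> x" "y' = j \<oplus> y"
      by (auto simp: a_r_coset_def')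
    have c: "i \<in> carrier L" "j \<in> carrier L" using ij I.subset by auto
    have m: "i \<otimes> j \<in> I" "x \<otimes> j \<in> I" "i \<otimes> y \<in> I"
      using I ij c assms by (auto simp: leibniz_ideal_def)
    have "x' \<otimes> y' = ((i \<otimes> j \<oplus> x \<otimes> j) \<oplus> i \<otimes> y) \<oplus> x \<otimes> y"
      using c assms
      by (simp add: e bracket_add_left bracket_add_right bracket_closed M.a_ac)
    then show ?thesis
      using m assms by (intro coset_eqI[of "(i \<otimes> j \<oplus> x \<otimes> j) \<oplus> i \<otimes> y"]) (auto simp: bracket_closed)
  qed
  moreover have "x \<in> I +> x" "y \<in> I +> y" using assms by (auto intro: I.a_rcos_self)
  ultimately show ?thesis unfolding rcoset_mult_def by blast
qed

lemma coset_smult: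
  assumes "c \<in> carrier F" "x \<in> carrier L"
  shows "(\<Union>y\<in>I +> x. I +> (c \<odot> y)) = I +> (c \<odot> x)"
proof -
  have "I +> (c \<odot> y) = I +> (c \<odot> x)" if "y \<in> I +> x" for y
  proof -
    from that obtain i where i: "i \<in> I" "y = i \<oplus> x" by (auto simp: a_r_coset_def')
    then have "i \<in> carrier L" using I.subset by auto
    with i assms show ?thesis
      by (intro coset_eqI[of "c \<odot> i"]) (auto simp: smult_r_distr)
  qed
  moreover have "x \<in> I +> x" using assms by (auto intro: I.a_rcos_self)
  ultimately show ?thesis by blast
qed

lemma quotient_leibniz_algebra: "leibniz_algebra F (quotient_algebra L I)"
proof -
  define Q where "Q = quotient_algebra L I"
  have car: "carrier Q = (\<lambda>x. I +> x) ` carrier L"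
    by (auto simp: Q_def quotient_algebra_def A_RCOSETS_def')
  have add: "(I +> x) \<oplus>\<^bsub>Q\<^esub> (I +> y) = I +> (x \<oplus> y)" if "x \<in> carrier L" "y \<in> carrier L" for x y
    using that by (simp add: Q_def quotient_algebra_def I.a_rcos_sum)
  have mult: "(I +> x) \<otimes>\<^bsub>Q\<^esub> (I +> y) = I +> (x \<otimes> y)" if "x \<in> carrier L" "y \<in> carrier L" for x y
    using that by (simp add: Q_def quotient_algebra_def coset_bracket)
  have smult: "c \<odot>\<^bsub>Q\<^esub> (I +> x) = I +> (c \<odot> x)" if "c \<in> carrier F" "x \<in> carrier L" for c x
    using that by (simp add: Q_def quotient_algebra_def coset_smult)
  have zero: "\<zero>\<^bsub>Q\<^esub> = I +> \<zero>"
    using I.a_rcos_const[of "\<zero>"] by (simp add: Q_def quotient_algebra_def)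
  note ops = add mult smult zero
  have "abelian_group Q"
  proof (rule abelian_groupI)
    fix X assume "X \<in> carrier Q"
    then obtain x where x: "x \<in> carrier L" "X = I +> x" by (auto simp: car)
    then have "(I +> (\<ominus> x)) \<oplus>\<^bsub>Q\<^esub> X = \<zero>\<^bsub>Q\<^esub>" by (simp add: ops M.l_neg)
    moreover have "I +> (\<ominus> x) \<in> carrier Q" using x by (auto simp: car)
    ultimately show "\<exists>Y\<in>carrier Q. Y \<oplus>\<^bsub>Q\<^esub> X = \<zero>\<^bsub>Q\<^esub>" by blast
  qed (auto simp: car ops M.a_ac)
  then have "module F Q"
    by (intro moduleI R.cring_axioms)
      (auto simp: car ops smult_l_distr smult_r_distr smult_assoc1)
  then have vs: "vectorspace F Q"
    by (simp add: vectorspace_def field_axioms)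
  interpret Q: vectorspace F Q by (rule vs)
  have minus: "(I +> x) \<ominus>\<^bsub>Q\<^esub> (I +> y) = I +> (x \<ominus> y)"
    if "x \<in> carrier L" "y \<in> carrier L" for x y
  proof -
    have "\<ominus>\<^bsub>Q\<^esub> (I +> y) = (\<ominus>\<^bsub>F\<^esub> \<one>\<^bsub>F\<^esub>) \<odot>\<^bsub>Q\<^esub> (I +> y)"
      using that by (simp add: Q.smult_minus_1 car)
    also have "\<dots> = I +> (\<ominus> y)"
      using that by (simp add: ops smult_minus_1)
    finally show ?thesis
      using that by (simp add: a_minus_def ops)
  qed
  have "leibniz_algebra F Q"
    by (rule leibniz_algebra.intro[OF vs], rule leibniz_algebra_axioms.intro)
      (auto simp: car ops minus bracket_closed bracket_add_left bracket_add_right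
        bracket_smult_left bracket_smult_right leibniz_identity)
  then show ?thesis by (simp add: Q_def)
qed

end

end

lemma nonlie_almost_abelian_iff:
  "nonlie_almost_abelian F M \<longleftrightarrow> leibniz_algebra F M \<and>
     (\<exists>A y. leibniz_ideal F M A \<and> A \<noteq> {\<zero>\<^bsub>M\<^esub>} \<and> abelian_subset M A \<and> y \<in> carrier M \<and>
        carrier M = A <+>\<^bsub>M\<^esub> {c \<odot>\<^bsub>M\<^esub> y | c. c \<in> carrier F} \<and>
        (\<forall>a\<in>A. a \<otimes>\<^bsub>M\<^esub> y = a \<and> y \<otimes>\<^bsub>M\<^esub> a = \<zero>\<^bsub>M\<^esub>) \<and> y \<otimes>\<^bsub>M\<^esub> y = \<zero>\<^bsub>M\<^esub>)"
  (is "?l \<longleftrightarrow> ?r")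
proof
  assume ?l
  then obtain A y where M: "leibniz_algebra F M" and A: "leibniz_ideal F M A" "A \<noteq> {\<zero>\<^bsub>M\<^esub>}"
    "abelian_subset M A" and y: "y \<in> carrier M"
    and car: "carrier M = A <+>\<^bsub>M\<^esub> {c \<odot>\<^bsub>M\<^esub> y | c. c \<in> carrier F}"
    and ay: "\<And>a. a \<in> A \<Longrightarrow> a \<otimes>\<^bsub>M\<^esub> y = a" "\<And>a. a \<in> A \<Longrightarrow> y \<otimes>\<^bsub>M\<^esub> a = \<zero>\<^bsub>M\<^esub>"
    unfolding nonlie_almost_abelian_def by blast
  interpret leibniz_algebra F M by (rule M)
  interpret A: submodule F A M using A(1) by (simp add: leibniz_ideal_def subspace_iff)
  have Ac: "a \<in> A \<Longrightarrow> a \<in> carrier M" for a using A.subset by auto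
  have neg: "a \<in> A \<Longrightarrow> \<ominus>\<^bsub>M\<^esub> a \<in> A" for a
    using A.smult_closed[of "\<ominus>\<^bsub>F\<^esub> \<one>\<^bsub>F\<^esub>" a] by (simp add: smult_minus_1 Ac)
  have "y \<otimes>\<^bsub>M\<^esub> y \<in> A <+>\<^bsub>M\<^esub> {c \<odot>\<^bsub>M\<^esub> y | c. c \<in> carrier F}"
    using bracket_closed[OF y y] car by simp
  then obtain b c where b: "b \<in> A" and c: "c \<in> carrier F"
    and yy: "y \<otimes>\<^bsub>M\<^esub> y = b \<oplus>\<^bsub>M\<^esub> c \<odot>\<^bsub>M\<^esub> y"
    by (auto simp: set_add_def')
  obtain a where a: "a \<in> A" "a \<noteq> \<zero>\<^bsub>M\<^esub>" using A(2) A.zero_closed by blast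
  have "a \<otimes>\<^bsub>M\<^esub> (y \<otimes>\<^bsub>M\<^esub> y) = \<zero>\<^bsub>M\<^esub>"
    using leibniz_identity[OF Ac[OF a(1)] y y] ay(1)[OF a(1)] Ac[OF a(1)] by simp
  moreover have "a \<otimes>\<^bsub>M\<^esub> (y \<otimes>\<^bsub>M\<^esub> y) = c \<odot>\<^bsub>M\<^esub> a"
  proof -
    have "a \<otimes>\<^bsub>M\<^esub> b = \<zero>\<^bsub>M\<^esub>" using A(3) a(1) b by (simp add: abelian_subset_def)
    then show ?thesis
      using a(1) b c y ay(1)[OF a(1)]
      by (simp add: yy bracket_add_right bracket_smult_right Ac)
  qed
  ultimately have "c \<odot>\<^bsub>M\<^esub> a = \<zero>\<^bsub>M\<^esub>" by simp
  have c0: "c = \<zero>\<^bsub>F\<^esub>"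
  proof (rule ccontr)
    assume "c \<noteq> \<zero>\<^bsub>F\<^esub>"
    with c have "inv\<^bsub>F\<^esub> c \<in> carrier F" "inv\<^bsub>F\<^esub> c \<otimes>\<^bsub>F\<^esub> c = \<one>\<^bsub>F\<^esub>"
      using field_Units by auto
    then have "a = inv\<^bsub>F\<^esub> c \<odot>\<^bsub>M\<^esub> (c \<odot>\<^bsub>M\<^esub> a)"
      using c Ac[OF a(1)] by (simp flip: smult_assoc1)
    with \<open>c \<odot>\<^bsub>M\<^esub> a = \<zero>\<^bsub>M\<^esub>\<close> \<open>inv\<^bsub>F\<^esub> c \<in> carrier F\<close> a(2) show False by simp
  qed
  then have yy: "y \<otimes>\<^bsub>M\<^esub> y = b" using yy y b by (simp add: Ac)
  define b' where "b' = \<ominus>\<^bsub>M\<^esub> b"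
  have b': "b' \<in> A" "b \<oplus>\<^bsub>M\<^esub> b' = \<zero>\<^bsub>M\<^esub>" using b neg by (auto simp: b'_def Ac M.r_neg)
  define z where "z = y \<oplus>\<^bsub>M\<^esub> b'"
  have zc: "z \<in> carrier M" using y b' by (simp add: z_def Ac)
  have az: "a \<otimes>\<^bsub>M\<^esub> z = a" "z \<otimes>\<^bsub>M\<^esub> a = \<zero>\<^bsub>M\<^esub>" if "a \<in> A" for a
    using that ay[OF that] A(3) b' y
    by (auto simp: z_def bracket_add_left bracket_add_right Ac abelian_subset_def)
  have "z \<otimes>\<^bsub>M\<^esub> z = y \<otimes>\<^bsub>M\<^esub> z \<oplus>\<^bsub>M\<^esub> b' \<otimes>\<^bsub>M\<^esub> z"
    using y b' zc by (subst (1) z_def) (simp add: bracket_add_left Ac)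
  also have "\<dots> = b \<oplus>\<^bsub>M\<^esub> b'"
    using az(1)[OF b'(1)] ay(2)[OF b'(1)] y b' b
    by (simp add: z_def bracket_add_right yy Ac)
  finally have zz: "z \<otimes>\<^bsub>M\<^esub> z = \<zero>\<^bsub>M\<^esub>" using b' by simp
  have "carrier M \<subseteq> A <+>\<^bsub>M\<^esub> {c \<odot>\<^bsub>M\<^esub> z | c. c \<in> carrier F}"
  proof
    fix v assume "v \<in> carrier M"
    then obtain a c where v: "a \<in> A" "c \<in> carrier F" "v = a \<oplus>\<^bsub>M\<^esub> c \<odot>\<^bsub>M\<^esub> y"
      using car by (auto simp: set_add_def')
    have "y = b \<oplus>\<^bsub>M\<^esub> z"
      using b b' y by (simp add: z_def Ac) (metis Ac M.add.m_lcomm M.r_zero)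
    then have "v = (a \<oplus>\<^bsub>M\<^esub> c \<odot>\<^bsub>M\<^esub> b) \<oplus>\<^bsub>M\<^esub> c \<odot>\<^bsub>M\<^esub> z"
      using v b zc by (simp add: smult_r_distr Ac M.a_assoc)
    moreover have "a \<oplus>\<^bsub>M\<^esub> c \<odot>\<^bsub>M\<^esub> b \<in> A" using v b by auto
    ultimately show "v \<in> A <+>\<^bsub>M\<^esub> {c \<odot>\<^bsub>M\<^esub> z | c. c \<in> carrier F}"
      using v by (auto simp: set_add_def')
  qed
  moreover have "A <+>\<^bsub>M\<^esub> {c \<odot>\<^bsub>M\<^esub> z | c. c \<in> carrier F} \<subseteq> carrier M"
    using zc by (auto simp: set_add_def' Ac)
  ultimately show ?r using M A zc az zz by blast
next
  assume ?r
  then show ?l unfolding nonlie_almost_abelian_def by blast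
qed

end

theory Submission
  imports Defs
begin

text \<open>
  Both sides are equivalent to the existence of an element \<open>z\<close> such that, with \<open>R\<close> denoting right
  multiplication by \<open>z\<close>, \<open>L = R(L) + F z\<close>, $[L, R(L)] = 0$, $R^m z = 0$ and
  $R^{m+1} = R^m \neq 0$. By the Fitting decomposition, \<open>L\<close> is then the direct sum of a nilpotent
  cyclic algebra generated by \<open>z\<close> and the space of fixed points of \<open>R\<close>. If \<open>e \<noteq> 0\<close> is a fixed
  point and \<open>x = z + e\<close>, then $x^i = R^{i-1} z + e$, which gives (ii); case (i) is \<open>m = 1\<close>.

  Every subalgebra not contained in \<open>R(L)\<close> contains \<open>(R - 1) L\<close>. This makes all subalgebras weak
  quasi-ideals, and it puts \<open>(R - 1) R(L)\<close> into the Frattini ideal.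

  Conversely, let \<open>y\<close> act as the identity on \<open>N/\<phi>\<close>, where \<open>N/\<phi>\<close> is the abelian ideal of \<open>L/\<phi>\<close>.
  The elements $[n,y] + [y,n]$ lie in the right centre \<open>Z\<close>, the set of all \<open>k\<close> with $[L,k] = 0$,
  so \<open>L = Z + F y + \<phi>\<close>, hence \<open>L = Z + F y\<close> because \<open>\<phi>\<close> consists of nongenerators, and
  \<open>N = Z\<close>. Subtracting an element of \<open>\<phi>\<close> from \<open>y\<close> gives \<open>z\<close> with $R^m z = 0$. For \<open>n \<in> N\<close> the
  weak quasi-ideal condition on \<open>F n\<close> and the subalgebra generated by \<open>z\<close> yields that
  $[n,z] - n$ lies in the latter, so it is killed by $R^m$.
\<close>

subsection \<open>Subspaces\<close>

text \<open>A dimension bound takes the place of Zorn's lemma. Among the independent sets that lie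
  in some admissible submodule above \<open>U0\<close>, take a maximal one, \<open>A\<close>. A
  larger admissible \<open>W\<close> offers no further independent vector, so \<open>W\<close> lies
  in the span of \<open>A\<close> and hence in \<open>U\<close>.\<close>

lemma (in vectorspace) maximal_submodule_exists:
  assumes fd: fin_dim and U0: "P U0" and P: "\<And>U. P U \<Longrightarrow> submodule K U V"
  obtains U where "P U" "U0 \<subseteq> U" "\<And>W. P W \<Longrightarrow> U \<subseteq> W \<Longrightarrow> W = U"
proof -
  let ?Q = "\<lambda>A. lin_indpt A \<and> (\<exists>U. P U \<and> U0 \<subseteq> U \<and> A \<subseteq> U)"
  have bd: "finite A \<and> card A \<le> dim" if A: "?Q A" for A
  proof -
    from A obtain U where "P U" "A \<subseteq> U" by blast
    then have "A \<subseteq> carrier V" using submodule.subset[OF P] by blast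
    then show ?thesis using li_le_dim[OF fd] A by blast
  qed
  have "?Q {}" using U0 by (auto simp: lin_dep_def)
  then obtain A where A: "maximal A ?Q" using maximal_exists[of ?Q dim "{}"] bd by blast
  then obtain U where U: "P U" "U0 \<subseteq> U" "A \<subseteq> U" and li: "lin_indpt A"
    unfolding maximal_def by blast
  have "W = U" if W: "P W" "U \<subseteq> W" for W
  proof
    have Ac: "A \<subseteq> carrier V" using U submodule.subset[OF P] by blast
    have "v \<in> span A" if v: "v \<in> W" for v
    proof (rule ccontr)
      assume n: "v \<notin> span A"
      have vc: "v \<in> carrier V" using v W submodule.subset[OF P] by blast
      have nA: "v \<notin> A" using n in_own_span[OF Ac] by blast
      have "lin_indpt (A \<union> {v})" using lin_dep_iff_in_span[OF Ac li vc nA] n by blast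
      then have "?Q (A \<union> {v})" using U W v by blast
      then show False using A nA unfolding maximal_def by blast
    qed
    then show "W \<subseteq> U" using span_is_subset[OF U(3) P[OF U(1)]] by blast
  qed (rule W)
  with U show thesis using that by blast
qed

text \<open>The vectors are added from the last to the first, each outside the span of its
  successors. Injectivity is recorded because independence of the image set alone would not notice
  repeated vectors.\<close>

lemma (in vectorspace) lin_indpt_family:
  fixes v :: "nat \<Rightarrow> 'c"
  assumes c: "\<And>i. v i \<in> carrier V"
    and ns: "\<And>j. j < n \<Longrightarrow> v j \<notin> span (v ` {j<..<n})"
  shows "inj_on v {..<n} \<and> lin_indpt (v ` {..<n})"
proof -
  have "lin_indpt (v ` {n - i..<n}) \<and> inj_on v {n - i..<n}" if "i \<le> n" for i
    using that
  proof (induction i)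
    case 0
    then show ?case by (simp add: lin_dep_def)
  next
    case (Suc i)
    define j where "j = n - Suc i"
    have j: "j < n" "n - i = Suc j" using Suc.prems by (auto simp: j_def)
    have eq: "{j<..<n} = {n - i..<n}" using j by auto
    have sp: "v j \<notin> span (v ` {n - i..<n})" using ns[OF j(1)] by (simp add: eq)
    have vc: "v ` {n - i..<n} \<subseteq> carrier V" using c by auto
    have nin: "v j \<notin> v ` {n - i..<n}" using sp in_own_span[OF vc] by blast
    have ins: "{j..<n} = insert j {n - i..<n}" using j by auto
    have "lin_indpt (v ` {n - i..<n} \<union> {v j})"
      using lin_dep_iff_in_span[OF vc _ c nin] sp Suc by simp
    moreover have "v ` {j..<n} = v ` {n - i..<n} \<union> {v j}" by (auto simp: ins)
    ultimately show ?case
      using Suc nin by (simp add: j_def[symmetric] ins) blast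
  qed
  from this[of n] show ?thesis by (simp add: atLeast0LessThan)
qed

section \<open>Additive cancellation; submodules as preimages, images, equalizers and sums\<close>

context module
begin

lemma add_minus_cancel_right:
  "a \<in> carrier M \<Longrightarrow> b \<in> carrier M \<Longrightarrow> (a \<oplus>\<^bsub>M\<^esub> b) \<ominus>\<^bsub>M\<^esub> b = a"
  by (simp add: M.minus_eq M.a_assoc M.r_neg)

lemma add_minus_cancel_left:
  "a \<in> carrier M \<Longrightarrow> b \<in> carrier M \<Longrightarrow> (a \<oplus>\<^bsub>M\<^esub> b) \<ominus>\<^bsub>M\<^esub> a = b"
  using add_minus_cancel_right[of b a] M.a_comm[of a b] by simp

lemma minus_add_cancel:
  "a \<in> carrier M \<Longrightarrow> b \<in> carrier M \<Longrightarrow> (a \<ominus>\<^bsub>M\<^esub> b) \<oplus>\<^bsub>M\<^esub> b = a"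
  by (simp add: M.minus_eq M.a_assoc M.l_neg)

lemma add_minus_cancel:
  "a \<in> carrier M \<Longrightarrow> b \<in> carrier M \<Longrightarrow> b \<oplus>\<^bsub>M\<^esub> (a \<ominus>\<^bsub>M\<^esub> b) = a"
  using minus_add_cancel[of a b] M.a_comm[of b "a \<ominus>\<^bsub>M\<^esub> b"] by simp

lemma minus_minus_cancel:
  "a \<in> carrier M \<Longrightarrow> b \<in> carrier M \<Longrightarrow> a \<ominus>\<^bsub>M\<^esub> (a \<ominus>\<^bsub>M\<^esub> b) = b"
  using add_minus_cancel_left[of "a \<ominus>\<^bsub>M\<^esub> b" b] by (simp add: minus_add_cancel)

lemma minus_add_minus:
  "a \<in> carrier M \<Longrightarrow> b \<in> carrier M \<Longrightarrow> c \<in> carrier M \<Longrightarrow>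
    (a \<ominus>\<^bsub>M\<^esub> b) \<oplus>\<^bsub>M\<^esub> (b \<ominus>\<^bsub>M\<^esub> c) = a \<ominus>\<^bsub>M\<^esub> c"
  using add_minus_cancel[of "b \<ominus>\<^bsub>M\<^esub> c" b]
  by (simp add: M.minus_eq M.a_assoc M.r_neg1)

lemma submoduleI':
  assumes "N \<subseteq> carrier M" "\<And>v w. v \<in> N \<Longrightarrow> w \<in> N \<Longrightarrow> v \<oplus>\<^bsub>M\<^esub> w \<in> N" "\<zero>\<^bsub>M\<^esub> \<in> N"
    "\<And>c v. c \<in> carrier R \<Longrightarrow> v \<in> N \<Longrightarrow> c \<odot>\<^bsub>M\<^esub> v \<in> N"
  shows "submodule R N M"
  using assms by (intro submodule.intro module_axioms)

lemma submodule_minus_closed: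
  assumes "submodule R N M" "v \<in> N" "w \<in> N"
  shows "v \<ominus>\<^bsub>M\<^esub> w \<in> N"
proof -
  interpret N: submodule R N M by fact
  have "(\<ominus> \<one>) \<odot>\<^bsub>M\<^esub> w \<in> N" using assms by auto
  moreover have "w \<in> carrier M" using assms N.subset by auto
  ultimately show ?thesis using assms by (simp add: smult_minus_1 a_minus_def)
qed

lemma submodule_preimage:
  assumes "f \<in> module_hom R M M" "submodule R W M"
  shows "submodule R {u \<in> carrier M. f u \<in> W} M"
proof -
  interpret mod_hom R M M f using assms by unfold_locales
  interpret W: submodule R W M by fact
  show ?thesis by (rule submoduleI') (auto simp: f0_is_0)
qed

lemma submodule_image:
  assumes "f \<in> module_hom R M M" "submodule R W M"
  shows "submodule R (f ` W) M"
proof -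
  interpret mod_hom R M M f using assms by unfold_locales
  interpret W: submodule R W M by fact
  have Wc: "w \<in> W \<Longrightarrow> w \<in> carrier M" for w using W.subset by blast
  show ?thesis
  proof (rule submoduleI')
    show "v \<oplus>\<^bsub>M\<^esub> w \<in> f ` W" if vw: "v \<in> f ` W" "w \<in> f ` W" for v w
    proof -
      obtain a where a: "a \<in> W" "v = f a" using vw(1) by (rule imageE)
      obtain b where b: "b \<in> W" "w = f b" using vw(2) by (rule imageE)
      have "f (a \<oplus>\<^bsub>M\<^esub> b) \<in> f ` W" by (rule imageI) (rule W.m_closed[OF a(1) b(1)])
      then show ?thesis by (simp add: a b Wc)
    qed
    show "c \<odot>\<^bsub>M\<^esub> v \<in> f ` W" if c: "c \<in> carrier R" and v: "v \<in> f ` W" for c v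
    proof -
      obtain a where a: "a \<in> W" "v = f a" using v by (rule imageE)
      have "f (c \<odot>\<^bsub>M\<^esub> a) \<in> f ` W" by (rule imageI) (rule W.smult_closed[OF c a(1)])
      then show ?thesis by (simp add: a c Wc)
    qed
    have "f \<zero>\<^bsub>M\<^esub> \<in> f ` W" by (rule imageI) (rule W.zero_closed)
    then show "\<zero>\<^bsub>M\<^esub> \<in> f ` W" by (simp add: f0_is_0)
  qed (use Wc in auto)
qed

lemma submodule_equalizer:
  assumes "f \<in> module_hom R M M" "g \<in> module_hom R M M"
  shows "submodule R {u \<in> carrier M. f u = g u} M"
proof -
  interpret f: mod_hom R M M f using assms by unfold_locales
  interpret g: mod_hom R M M g using assms by unfold_locales
  show ?thesis by (rule submoduleI') (auto simp: f.f0_is_0 g.f0_is_0)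
qed

lemma module_hom_diff:
  assumes f: "f \<in> module_hom R M M" and g: "g \<in> module_hom R M M"
  shows "(\<lambda>u. f u \<ominus>\<^bsub>M\<^esub> g u) \<in> module_hom R M M"
proof -
  have c: "f u \<in> carrier M" "g u \<in> carrier M" if "u \<in> carrier M" for u
    using that f g by (auto simp: module_hom_def)
  have "(a \<oplus>\<^bsub>M\<^esub> b) \<ominus>\<^bsub>M\<^esub> (c \<oplus>\<^bsub>M\<^esub> d) = (a \<ominus>\<^bsub>M\<^esub> c) \<oplus>\<^bsub>M\<^esub> (b \<ominus>\<^bsub>M\<^esub> d)"
    if "a \<in> carrier M" "b \<in> carrier M" "c \<in> carrier M" "d \<in> carrier M" for a b c d
    using that M.a_lcomm[of b "\<ominus>\<^bsub>M\<^esub> c" "\<ominus>\<^bsub>M\<^esub> d"]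
    by (simp add: M.minus_eq M.minus_add M.a_assoc)
  then show ?thesis
    unfolding module_hom_def
    by (auto simp: c module_hom_add[OF f] module_hom_add[OF g] module_hom_smult[OF f]
        module_hom_smult[OF g] M.minus_eq smult_r_distr smult_r_minus)
qed

lemma submodule_set_add:
  assumes "submodule R U M" "submodule R W M"
  shows "submodule R (U <+>\<^bsub>M\<^esub> W) M" "U \<subseteq> U <+>\<^bsub>M\<^esub> W" "W \<subseteq> U <+>\<^bsub>M\<^esub> W"
proof -
  have eq: "U <+>\<^bsub>M\<^esub> W = submodule_sum U W"
    unfolding set_add_def' submodule_sum_def by force
  show "submodule R (U <+>\<^bsub>M\<^esub> W) M" unfolding eq by (rule sum_is_submodule[OF assms])
  show "U \<subseteq> U <+>\<^bsub>M\<^esub> W" unfolding eq by (rule in_sum[OF assms])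
  show "W \<subseteq> U <+>\<^bsub>M\<^esub> W" unfolding eq msum_comm[OF assms] by (rule in_sum[OF assms(2,1)])
qed

lemma submodule_zero: "submodule R {\<zero>\<^bsub>M\<^esub>} M"
  by (rule submoduleI') auto

lemma submodule_carrier: "submodule R (carrier M) M"
  by (rule submoduleI') auto

text \<open>The sum of \<open>N\<close> and a line is kept as an explicit set, so that membership
  delivers the coefficient of \<open>x\<close>, on which the later arguments turn.\<close>

lemma submodule_plus_line:
  assumes "submodule R N M" "x \<in> carrier M"
  shows "submodule R {n \<oplus>\<^bsub>M\<^esub> c \<odot>\<^bsub>M\<^esub> x | n c. n \<in> N \<and> c \<in> carrier R} M"
    (is "submodule R ?S M")
proof -
  interpret N: submodule R N M by fact
  have Nc: "n \<in> N \<Longrightarrow> n \<in> carrier M" for n using N.subset by auto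
  show ?thesis
  proof (rule submoduleI')
    fix v w assume "v \<in> ?S" "w \<in> ?S"
    then obtain n c n' c' where "v = n \<oplus>\<^bsub>M\<^esub> c \<odot>\<^bsub>M\<^esub> x" "w = n' \<oplus>\<^bsub>M\<^esub> c' \<odot>\<^bsub>M\<^esub> x"
      "n \<in> N" "n' \<in> N" "c \<in> carrier R" "c' \<in> carrier R" by auto
    moreover from this have "v \<oplus>\<^bsub>M\<^esub> w = (n \<oplus>\<^bsub>M\<^esub> n') \<oplus>\<^bsub>M\<^esub> (c \<oplus> c') \<odot>\<^bsub>M\<^esub> x"
      using assms Nc by (simp add: smult_l_distr M.a_ac)
    ultimately show "v \<oplus>\<^bsub>M\<^esub> w \<in> ?S" by blast
  next
    have "\<zero>\<^bsub>M\<^esub> = \<zero>\<^bsub>M\<^esub> \<oplus>\<^bsub>M\<^esub> \<zero> \<odot>\<^bsub>M\<^esub> x" using assms by simp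
    then show "\<zero>\<^bsub>M\<^esub> \<in> ?S" by (metis (mono_tags, lifting) N.zero_closed R.zero_closed mem_Collect_eq)
  next
    fix a v assume a: "a \<in> carrier R" "v \<in> ?S"
    then obtain n c where "v = n \<oplus>\<^bsub>M\<^esub> c \<odot>\<^bsub>M\<^esub> x" "n \<in> N" "c \<in> carrier R" by auto
    moreover from this have "a \<odot>\<^bsub>M\<^esub> v = a \<odot>\<^bsub>M\<^esub> n \<oplus>\<^bsub>M\<^esub> (a \<otimes> c) \<odot>\<^bsub>M\<^esub> x"
      using assms Nc a by (simp add: smult_r_distr smult_assoc1)
    ultimately show "a \<odot>\<^bsub>M\<^esub> v \<in> ?S" using a by blast
  qed (use assms Nc in auto)
qed

end

lemma (in vectorspace) smult_mem_cancel:
  assumes N: "submodule K N V" and v: "v \<in> carrier V" and c: "c \<in> carrier K" "c \<noteq> \<zero>\<^bsub>K\<^esub>"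
    and cv: "c \<odot>\<^bsub>V\<^esub> v \<in> N"
  shows "v \<in> N"
  using mult_inverse[OF c(1) v refl c(2)] submodule.smult_closed[OF N _ cv]
    field_Units c by (metis DiffI R.Units_inv_closed singletonD)

text \<open>A nonzero \<open>c\<close> would be invertible and would put \<open>v\<close> itself
  into \<open>N\<close>.\<close>

lemma (in vectorspace) plus_line_coeff_zero:
  assumes N: "submodule K N V" and v: "v \<in> carrier V" "v \<notin> N"
    and n: "n \<in> N" and c: "c \<in> carrier K" and mem: "n \<oplus>\<^bsub>V\<^esub> c \<odot>\<^bsub>V\<^esub> v \<in> N"
  shows "c = \<zero>\<^bsub>K\<^esub>"
proof (rule ccontr)
  assume c0: "c \<noteq> \<zero>\<^bsub>K\<^esub>"
  have nc: "n \<in> carrier V" using submodule.subset[OF N] n by blast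
  have "(n \<oplus>\<^bsub>V\<^esub> c \<odot>\<^bsub>V\<^esub> v) \<ominus>\<^bsub>V\<^esub> n \<in> N" by (rule submodule_minus_closed[OF N mem n])
  then have "c \<odot>\<^bsub>V\<^esub> v \<in> N" using add_minus_cancel_left[OF nc] c v by simp
  then show False using smult_mem_cancel[OF N v(1) c c0] v(2) by blast
qed

subsection \<open>Powers of right multiplications\<close>

context leibniz_algebra
begin

definition rmul :: "'v \<Rightarrow> nat \<Rightarrow> 'v \<Rightarrow> 'v" where
  "rmul z i = (\<lambda>v. v \<otimes> z) ^^ i"

lemma rmul_0 [simp]: "rmul z 0 u = u"
  by (simp add: rmul_def)

lemma rmul_Suc [simp]: "rmul z (Suc i) u = rmul z i u \<otimes> z"
  by (simp add: rmul_def)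

lemma rmul_add: "rmul z (i + j) u = rmul z i (rmul z j u)"
  by (simp add: rmul_def funpow_add)

lemma rmul_Suc2: "rmul z i (u \<otimes> z) = rmul z i u \<otimes> z"
  using rmul_add[of z i 1 u] by simp

lemma rmul_commute: "rmul z i (rmul z j u) = rmul z j (rmul z i u)"
  by (metis rmul_add add.commute)

lemma rmul_closed [simp, intro]: "z \<in> carrier L \<Longrightarrow> u \<in> carrier L \<Longrightarrow> rmul z i u \<in> carrier L"
  by (induction i) (auto simp: bracket_closed)

lemma rmul_hom: "z \<in> carrier L \<Longrightarrow> rmul z i \<in> module_hom F L L"
  unfolding module_hom_def
  by (induction i) (auto simp: bracket_closed bracket_add_left bracket_smult_left)

lemma rmul_plus:
  "z \<in> carrier L \<Longrightarrow> u \<in> carrier L \<Longrightarrow> v \<in> carrier L \<Longrightarrow> rmul z i (u \<oplus> v) = rmul z i u \<oplus> rmul z i v"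
  using module_hom_add[OF rmul_hom] .

lemma rmul_smult:
  "z \<in> carrier L \<Longrightarrow> c \<in> carrier F \<Longrightarrow> u \<in> carrier L \<Longrightarrow> rmul z i (c \<odot> u) = c \<odot> rmul z i u"
  using module_hom_smult[OF rmul_hom] .

lemma rmul_minus:
  assumes "z \<in> carrier L" "u \<in> carrier L" "v \<in> carrier L"
  shows "rmul z i (u \<ominus> v) = rmul z i u \<ominus> rmul z i v"
  using assms rmul_plus[of z u "\<ominus> v" i] rmul_smult[of z "\<ominus>\<^bsub>F\<^esub> \<one>\<^bsub>F\<^esub>" v i]
  by (simp add: M.minus_eq smult_minus_1)

lemma rmul_zero: "z \<in> carrier L \<Longrightarrow> rmul z i \<zero> = \<zero>"
  by (induction i) (auto simp: bracket_zero_left)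

text \<open>The shift by one comes from \<open>x\<close> being its own first power. Truncated
  subtraction gives the junk value \<open>x\<close> at exponent 0 on both sides.\<close>

lemma lpow_rmul: "lpow L x n = rmul x (n - 1) x"
  by (simp add: lpow_def rmul_def)

lemma subalgebra_iff: "subalgebra F L U \<longleftrightarrow> submodule F U L \<and> (\<forall>u\<in>U. \<forall>v\<in>U. u \<otimes> v \<in> U)"
  by (simp add: subalgebra_def subspace_iff)

text \<open>Finite dimension allows maximality among proper subalgebras. A proper subalgebra is thus
  enclosed in a maximal one, which also contains the Frattini ideal.\<close>

lemma subalgebra_maximal_exists:
  assumes fd: fin_dim and P: "subalgebra F L P" "P \<noteq> carrier L"
  obtains M where "maximal_subalgebra F L M" "P \<subseteq> M"
proof -
  obtain M where M: "subalgebra F L M \<and> M \<noteq> carrier L" "P \<subseteq> M"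
    and max: "\<And>W. subalgebra F L W \<and> W \<noteq> carrier L \<Longrightarrow> M \<subseteq> W \<Longrightarrow> W = M"
    using maximal_submodule_exists[OF fd, of "\<lambda>U. subalgebra F L U \<and> U \<noteq> carrier L" P] P
    by (auto simp: subalgebra_iff)
  then show thesis using that unfolding maximal_subalgebra_def by metis
qed

subsection \<open>Almost abelian quotients and weak quasi-ideals\<close>

lemma leibniz_ideal_iff:
  "leibniz_ideal F L I \<longleftrightarrow> submodule F I L \<and> (\<forall>i\<in>I. \<forall>x\<in>carrier L. i \<otimes> x \<in> I \<and> x \<otimes> i \<in> I)"
  by (simp add: leibniz_ideal_def subspace_iff)

section \<open>Quotients in terms of representatives\<close>

context
  fixes I
  assumes I: "leibniz_ideal F L I"
begin

lemma ideal_submodule: "submodule F I L"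
  using I by (simp add: leibniz_ideal_iff)

lemma quotient_carrier: "carrier (quotient_algebra L I) = (\<lambda>x. I +> x) ` carrier L"
  by (auto simp: quotient_algebra_def A_RCOSETS_def')

lemma quotient_add:
  "x \<in> carrier L \<Longrightarrow> y \<in> carrier L \<Longrightarrow>
    (I +> x) \<oplus>\<^bsub>quotient_algebra L I\<^esub> (I +> y) = I +> (x \<oplus> y)"
  by (simp add: quotient_algebra_def
      abelian_subgroup.a_rcos_sum[OF submodule_abelian_subgroup[OF ideal_submodule]])

lemma quotient_mult:
  "x \<in> carrier L \<Longrightarrow> y \<in> carrier L \<Longrightarrow>
    (I +> x) \<otimes>\<^bsub>quotient_algebra L I\<^esub> (I +> y) = I +> (x \<otimes> y)"
  by (simp add: quotient_algebra_def coset_bracket[OF I])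

lemma quotient_smult:
  "c \<in> carrier F \<Longrightarrow> x \<in> carrier L \<Longrightarrow>
    c \<odot>\<^bsub>quotient_algebra L I\<^esub> (I +> x) = I +> (c \<odot> x)"
  by (simp add: quotient_algebra_def coset_smult[OF I])

lemma quotient_zero: "\<zero>\<^bsub>quotient_algebra L I\<^esub> = I +> \<zero>"
proof -
  have "I \<subseteq> carrier L" using ideal_submodule submodule.subset by blast
  then have "I +> \<zero> = I" by (auto simp: a_r_coset_def' subset_eq)
  then show ?thesis by (simp add: quotient_algebra_def)
qed

lemmas quotient_ops = quotient_add quotient_mult quotient_smult quotient_zero

lemma coset_eq_iff:
  assumes "x \<in> carrier L" "y \<in> carrier L"
  shows "I +> x = I +> y \<longleftrightarrow> (\<exists>i\<in>I. x = i \<oplus> y)"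
proof
  assume "I +> x = I +> y"
  then have "x \<in> I +> y"
    using abelian_subgroup.a_rcos_self[OF submodule_abelian_subgroup[OF ideal_submodule] assms(1)]
    by simp
  then show "\<exists>i\<in>I. x = i \<oplus> y" by (auto simp: a_r_coset_def')
qed (use coset_eqI[OF I] assms in blast)

lemma coset_eq_zero_iff:
  assumes "x \<in> carrier L"
  shows "I +> x = I +> \<zero> \<longleftrightarrow> x \<in> I"
proof -
  have "I \<subseteq> carrier L" using ideal_submodule submodule.subset by blast
  then show ?thesis using coset_eq_iff[OF assms, of \<zero>] by (auto simp: subset_eq)
qed

text \<open>Here \<open>N\<close> is the preimage of the abelian ideal, \<open>N \<noteq> I\<close>
  says that this ideal is nonzero, and the identities in the quotient become congruences modulo
  \<open>I\<close>.\<close>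

lemma nonlie_almost_abelian_quotientI:
  assumes N: "submodule F N L" "I \<subseteq> N" "N \<noteq> I" and y: "y \<in> carrier L"
    and dec: "\<And>u. u \<in> carrier L \<Longrightarrow> \<exists>n\<in>N. \<exists>c\<in>carrier F. u = n \<oplus> c \<odot> y"
    and nn: "\<And>n n'. n \<in> N \<Longrightarrow> n' \<in> N \<Longrightarrow> n \<otimes> n' \<in> I"
    and ny: "\<And>n. n \<in> N \<Longrightarrow> \<exists>i\<in>I. n \<otimes> y = i \<oplus> n"
    and yn: "\<And>n. n \<in> N \<Longrightarrow> y \<otimes> n \<in> I"
  shows "nonlie_almost_abelian F (quotient_algebra L I)"
proof -
  define Q where "Q = quotient_algebra L I"
  interpret N: submodule F N L by fact
  interpret Q: leibniz_algebra F Q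
    unfolding Q_def by (rule quotient_leibniz_algebra[OF I])
  note ops = quotient_ops[folded Q_def]
  note car = quotient_carrier[folded Q_def]
  have Nc: "n \<in> carrier L" if "n \<in> N" for n using N.subset that by blast
  define A where "A = (\<lambda>x. I +> x) ` N"
  \<comment> \<open>That \<open>N\<close> is an ideal follows from the three congruences once
    \<open>u\<close> is written as \<open>n' \<oplus> c \<odot> y\<close>.\<close>
  have nu: "n \<otimes> u \<in> N \<and> u \<otimes> n \<in> N" if n: "n \<in> N" and u: "u \<in> carrier L" for n u
  proof -
    obtain n' c where u': "n' \<in> N" "c \<in> carrier F" "u = n' \<oplus> c \<odot> y" using dec[OF u] by blast
    obtain i where i: "i \<in> I" "n \<otimes> y = i \<oplus> n" using ny[OF n] by blast
    have "n \<otimes> n' \<in> N" "n' \<otimes> n \<in> N" "y \<otimes> n \<in> N" "i \<in> N"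
      using nn[OF n u'(1)] nn[OF u'(1) n] yn[OF n] N(2) i by auto
    then show ?thesis
      using u' n y i
      by (simp add: bracket_add_left bracket_add_right bracket_smult_left bracket_smult_right Nc)
  qed
  have sub: "submodule F A Q"
  proof (rule Q.submoduleI')
    show "v \<oplus>\<^bsub>Q\<^esub> w \<in> A" if "v \<in> A" "w \<in> A" for v w
      using that by (auto simp: A_def ops Nc)
    show "c \<odot>\<^bsub>Q\<^esub> v \<in> A" if "c \<in> carrier F" "v \<in> A" for c v
      using that by (auto simp: A_def ops Nc)
  qed (auto simp: A_def car Nc ops)
  have "leibniz_ideal F Q A"
    unfolding Q.leibniz_ideal_iff using sub nu by (auto simp: A_def car ops Nc)
  moreover have "A \<noteq> {\<zero>\<^bsub>Q\<^esub>}"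
  proof
    assume A0: "A = {\<zero>\<^bsub>Q\<^esub>}"
    have "n \<in> I" if "n \<in> N" for n
    proof -
      have "I +> n \<in> {\<zero>\<^bsub>Q\<^esub>}" using that unfolding A0[symmetric] A_def by blast
      then show ?thesis using coset_eq_zero_iff Nc[OF that] by (simp add: ops)
    qed
    then show False using N by blast
  qed
  moreover have "abelian_subset Q A"
    unfolding abelian_subset_def A_def
    by (auto simp: ops Nc coset_eq_zero_iff bracket_closed nn)
  moreover have "I +> y \<in> carrier Q" using y by (simp add: car)
  moreover have "carrier Q = A <+>\<^bsub>Q\<^esub> {c \<odot>\<^bsub>Q\<^esub> (I +> y) | c. c \<in> carrier F}"
  proof
    show "carrier Q \<subseteq> A <+>\<^bsub>Q\<^esub> {c \<odot>\<^bsub>Q\<^esub> (I +> y) | c. c \<in> carrier F}"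
    proof
      fix v assume "v \<in> carrier Q"
      then obtain u where u: "u \<in> carrier L" "v = I +> u" by (auto simp: car)
      obtain n c where "n \<in> N" "c \<in> carrier F" "u = n \<oplus> c \<odot> y" using dec[OF u(1)] by blast
      then have "I +> n \<in> A" "v = (I +> n) \<oplus>\<^bsub>Q\<^esub> c \<odot>\<^bsub>Q\<^esub> (I +> y)" "c \<in> carrier F"
        using u y by (auto simp: ops Nc A_def)
      then show "v \<in> A <+>\<^bsub>Q\<^esub> {c \<odot>\<^bsub>Q\<^esub> (I +> y) | c. c \<in> carrier F}"
        unfolding set_add_def' by blast
    qed
    show "A <+>\<^bsub>Q\<^esub> {c \<odot>\<^bsub>Q\<^esub> (I +> y) | c. c \<in> carrier F} \<subseteq> carrier Q"
      using y by (auto simp: set_add_def' A_def ops Nc car)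
  qed
  moreover have "a \<otimes>\<^bsub>Q\<^esub> (I +> y) = a \<and> (I +> y) \<otimes>\<^bsub>Q\<^esub> a = \<zero>\<^bsub>Q\<^esub>" if "a \<in> A" for a
  proof -
    obtain n where n: "n \<in> N" "a = I +> n" using \<open>a \<in> A\<close> by (auto simp: A_def)
    have "I +> (n \<otimes> y) = I +> n"
      using ny[OF n(1)] coset_eq_iff bracket_closed y Nc[OF n(1)] by blast
    moreover have "I +> (y \<otimes> n) = I +> \<zero>"
      using yn[OF n(1)] coset_eq_zero_iff bracket_closed y Nc[OF n(1)] by blast
    ultimately
    show ?thesis using n y Nc by (simp add: ops)
  qed
  ultimately show ?thesis
    unfolding nonlie_almost_abelian_def Q_def[symmetric] using Q.leibniz_algebra_axioms by blast
qed

text \<open>The converse translation, with \<open>N\<close> the full preimage of the abelian ideal.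
  The last conclusion comes from normalising the square of the acting element to zero in the
  quotient; it will place the higher powers of \<open>y\<close> in the ideal.\<close>

lemma nonlie_almost_abelian_quotientE:
  assumes "nonlie_almost_abelian F (quotient_algebra L I)"
  obtains N y where "submodule F N L" "I \<subseteq> N" "N \<noteq> I" "y \<in> carrier L"
    "\<And>u. u \<in> carrier L \<Longrightarrow> \<exists>n\<in>N. \<exists>c\<in>carrier F. u = n \<oplus> c \<odot> y"
    "\<And>n n'. n \<in> N \<Longrightarrow> n' \<in> N \<Longrightarrow> n \<otimes> n' \<in> I"
    "\<And>n. n \<in> N \<Longrightarrow> \<exists>i\<in>I. n \<otimes> y = i \<oplus> n"
    "\<And>n. n \<in> N \<Longrightarrow> y \<otimes> n \<in> I" "y \<otimes> y \<in> I"
proof -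
  define Q where "Q = quotient_algebra L I"
  interpret I: submodule F I L by (rule ideal_submodule)
  interpret Q: leibniz_algebra F Q
    unfolding Q_def by (rule quotient_leibniz_algebra[OF I])
  note ops = quotient_ops[folded Q_def]
  note car = quotient_carrier[folded Q_def]
  have Ic: "i \<in> carrier L" if "i \<in> I" for i using I.subset that by blast
  obtain A Y where AY: "leibniz_ideal F Q A \<and> A \<noteq> {\<zero>\<^bsub>Q\<^esub>} \<and> abelian_subset Q A \<and> Y \<in> carrier Q \<and>
      carrier Q = A <+>\<^bsub>Q\<^esub> {c \<odot>\<^bsub>Q\<^esub> Y | c. c \<in> carrier F} \<and>
      (\<forall>a\<in>A. a \<otimes>\<^bsub>Q\<^esub> Y = a \<and> Y \<otimes>\<^bsub>Q\<^esub> a = \<zero>\<^bsub>Q\<^esub>) \<and> Y \<otimes>\<^bsub>Q\<^esub> Y = \<zero>\<^bsub>Q\<^esub>"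
    using assms[folded Q_def, unfolded nonlie_almost_abelian_iff] by (elim conjE exE) (rule that, intro conjI)
  then have A: "leibniz_ideal F Q A" "A \<noteq> {\<zero>\<^bsub>Q\<^esub>}" "abelian_subset Q A"
    and Y: "Y \<in> carrier Q" "carrier Q = A <+>\<^bsub>Q\<^esub> {c \<odot>\<^bsub>Q\<^esub> Y | c. c \<in> carrier F}"
    and YY: "Y \<otimes>\<^bsub>Q\<^esub> Y = \<zero>\<^bsub>Q\<^esub>"
    by - (elim conjE, assumption)+
  have aY: "\<And>a. a \<in> A \<Longrightarrow> a \<otimes>\<^bsub>Q\<^esub> Y = a" "\<And>a. a \<in> A \<Longrightarrow> Y \<otimes>\<^bsub>Q\<^esub> a = \<zero>\<^bsub>Q\<^esub>"
    using AY by blast+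
  interpret A: submodule F A Q using A(1) by (simp add: Q.leibniz_ideal_iff)
  obtain y where y: "y \<in> carrier L" "Y = I +> y" using Y(1) by (auto simp: car)
  define N where "N = {u \<in> carrier L. I +> u \<in> A}"
  have Nc: "n \<in> carrier L" if "n \<in> N" for n using that by (simp add: N_def)
  have Acc: "\<exists>u\<in>N. a = I +> u" if "a \<in> A" for a
    using that A.subset by (auto simp: car N_def)
  have N: "submodule F N L"
  proof (rule submoduleI')
    show "\<zero> \<in> N" using A.zero_closed by (simp add: N_def ops)
    show "v \<oplus> w \<in> N" if "v \<in> N" "w \<in> N" for v w
      using that A.m_closed[of "I +> v" "I +> w"] by (auto simp: N_def ops)
    show "c \<odot> v \<in> N" if "c \<in> carrier F" "v \<in> N" for c v
      using that A.smult_closed[of c "I +> v"] by (auto simp: N_def ops)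
  qed (auto simp: N_def)
  have IN: "I \<subseteq> N"
  proof
    fix i assume "i \<in> I"
    then have "I +> i = \<zero>\<^bsub>Q\<^esub>" using coset_eq_zero_iff[OF Ic[of i]] by (simp only: ops)
    then show "i \<in> N" using A.zero_closed \<open>i \<in> I\<close> Ic by (simp add: N_def)
  qed
  have NI: "N \<noteq> I"
  proof
    assume "N = I"
    then have "a = \<zero>\<^bsub>Q\<^esub>" if "a \<in> A" for a
      using Acc[OF that] coset_eq_zero_iff[OF Ic] unfolding ops by metis
    then show False using A(2) A.zero_closed by blast
  qed
  have nn: "n \<otimes> n' \<in> I" if "n \<in> N" "n' \<in> N" for n n'
  proof -
    have "(I +> n) \<otimes>\<^bsub>Q\<^esub> (I +> n') = \<zero>\<^bsub>Q\<^esub>"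
      using A(3) that by (simp add: N_def abelian_subset_def)
    then show ?thesis using that coset_eq_zero_iff Nc by (simp add: ops bracket_closed)
  qed
  have ny: "\<exists>i\<in>I. n \<otimes> y = i \<oplus> n" "y \<otimes> n \<in> I" if "n \<in> N" for n
  proof -
    have "(I +> n) \<otimes>\<^bsub>Q\<^esub> Y = (I +> n)" "Y \<otimes>\<^bsub>Q\<^esub> (I +> n) = \<zero>\<^bsub>Q\<^esub>"
      using aY that by (auto simp: N_def)
    then show "\<exists>i\<in>I. n \<otimes> y = i \<oplus> n" "y \<otimes> n \<in> I"
      using that coset_eq_zero_iff coset_eq_iff Nc y by (simp_all add: ops bracket_closed)
  qed
  have yy: "y \<otimes> y \<in> I"
    using YY y coset_eq_zero_iff by (simp add: ops bracket_closed)
  have dec: "\<exists>n\<in>N. \<exists>c\<in>carrier F. u = n \<oplus> c \<odot> y" if u: "u \<in> carrier L" for u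
  proof -
    have "I +> u \<in> A <+>\<^bsub>Q\<^esub> {c \<odot>\<^bsub>Q\<^esub> Y | c. c \<in> carrier F}"
      using u Y(2) by (auto simp: car)
    then obtain a c where ac: "a \<in> A" "c \<in> carrier F" "I +> u = a \<oplus>\<^bsub>Q\<^esub> c \<odot>\<^bsub>Q\<^esub> Y"
      unfolding set_add_def' by blast
    then obtain n where n: "n \<in> N" "a = I +> n" using Acc by blast
    have "I +> u = I +> (n \<oplus> c \<odot> y)" using ac n y Nc by (simp add: ops)
    then obtain i where i: "i \<in> I" "u = i \<oplus> (n \<oplus> c \<odot> y)"
      using coset_eq_iff[OF u, of "n \<oplus> c \<odot> y"] n y ac Nc by auto
    then have "u = (i \<oplus> n) \<oplus> c \<odot> y" using n y ac Nc Ic by (simp add: M.a_assoc)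
    moreover have "i \<oplus> n \<in> N" using submodule.m_closed[OF N] IN i n by blast
    ultimately show ?thesis using ac by blast
  qed
  show thesis by (rule that[OF N IN NI y(1) dec nn ny yy])
qed

end

section \<open>Weak quasi-ideals tested on single products\<close>

lemma weak_quasi_idealI:
  assumes U: "subalgebra F L U"
    and UV: "\<And>V u v. subalgebra F L V \<Longrightarrow> u \<in> U \<Longrightarrow> v \<in> V \<Longrightarrow>
      u \<otimes> v \<in> U <+>\<^bsub>L\<^esub> V \<and> v \<otimes> u \<in> U <+>\<^bsub>L\<^esub> V"
  shows "weak_quasi_ideal F L U"
  unfolding weak_quasi_ideal_def
proof (intro conjI allI impI)
  show "subalgebra F L U" by fact
  fix V assume V: "subalgebra F L V"
  have S: "submodule F (U <+>\<^bsub>L\<^esub> V) L"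
    using submodule_set_add(1) U V by (simp add: subalgebra_iff)
  have sub: "bracket_space F L U V \<subseteq> U <+>\<^bsub>L\<^esub> V" "bracket_space F L V U \<subseteq> U <+>\<^bsub>L\<^esub> V"
    unfolding bracket_space_def using UV[OF V] by (intro span_is_subset[OF _ S]; blast)+
  show "bracket_space F L U V <+>\<^bsub>L\<^esub> bracket_space F L V U \<subseteq> U <+>\<^bsub>L\<^esub> V"
  proof
    fix w assume "w \<in> bracket_space F L U V <+>\<^bsub>L\<^esub> bracket_space F L V U"
    then obtain h k where "h \<in> bracket_space F L U V" "k \<in> bracket_space F L V U" "w = h \<oplus> k"
      unfolding set_add_def' by blast
    then show "w \<in> U <+>\<^bsub>L\<^esub> V" using sub submodule.m_closed[OF S] by blast
  qed
qed

lemma weak_quasi_idealD: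
  assumes "weak_quasi_ideal F L U" "subalgebra F L V" "u \<in> U" "v \<in> V"
  shows "\<exists>a\<in>U. \<exists>b\<in>V. u \<otimes> v = a \<oplus> b"
proof -
  interpret U: submodule F U L using assms by (simp add: weak_quasi_ideal_def subalgebra_iff)
  interpret V: submodule F V L using assms by (simp add: subalgebra_iff)
  have UV: "{u \<otimes> v | u v. u \<in> U \<and> v \<in> V} \<subseteq> carrier L"
    "{v \<otimes> u | v u. v \<in> V \<and> u \<in> U} \<subseteq> carrier L"
    using U.subset V.subset bracket_closed by auto
  have "u \<otimes> v \<in> bracket_space F L U V"
    unfolding bracket_space_def using in_own_span[OF UV(1)] assms by blast
  \<comment> \<open>The other summand contains zero, so a single product counts as an element of the
    sum of both bracket spaces.\<close>
  moreover have "\<zero> \<in> bracket_space F L V U"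
    unfolding bracket_space_def using submodule.zero_closed[OF span_is_submodule[OF UV(2)]] .
  ultimately have "u \<otimes> v \<oplus> \<zero> \<in> bracket_space F L U V <+>\<^bsub>L\<^esub> bracket_space F L V U"
    unfolding set_add_def' by blast
  then have "u \<otimes> v \<oplus> \<zero> \<in> U <+>\<^bsub>L\<^esub> V" using assms unfolding weak_quasi_ideal_def by blast
  moreover have "u \<otimes> v \<in> carrier L" using UV assms by blast
  ultimately show ?thesis unfolding set_add_def' by auto
qed

end

subsection \<open>Right multiplications with a Fitting splitting\<close>

text \<open>With R for right multiplication by \<open>z\<close>: \<open>rmul_z\<close> puts
  \<open>z\<close> into the Fitting null component of R, while \<open>rmul_stable\<close> and
  \<open>rmul_nonzero\<close> say that the complementary component is nonzero and fixed pointwise by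
  R.\<close>

locale split_leibniz = leibniz_algebra F L
  for F :: "('f, 'r) ring_scheme" and L :: "('f, 'v, 'm) module_scheme" (structure) +
  fixes z :: 'v and m :: nat
  assumes z_closed [simp, intro]: "z \<in> carrier L"
    and decomp: "u \<in> carrier L \<Longrightarrow> \<exists>v\<in>carrier L. \<exists>c\<in>carrier F. u = v \<otimes> z \<oplus> c \<odot> z"
    and right_zero: "u \<in> carrier L \<Longrightarrow> v \<in> carrier L \<Longrightarrow> u \<otimes> (v \<otimes> z) = \<zero>"
    and rmul_z: "rmul z m z = \<zero>"
    and rmul_stable: "u \<in> carrier L \<Longrightarrow> rmul z (Suc m) u = rmul z m u"
    and rmul_nonzero: "\<exists>u\<in>carrier L. rmul z m u \<noteq> \<zero>"
begin

definition im :: "'v set" where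
  "im = (\<lambda>v. v \<otimes> z) ` carrier L"

lemma im_closed: "n \<in> im \<Longrightarrow> n \<in> carrier L"
  by (auto simp: im_def bracket_closed)

lemma bracket_im: "u \<in> carrier L \<Longrightarrow> n \<in> im \<Longrightarrow> u \<otimes> n = \<zero>"
  by (auto simp: im_def right_zero)

lemma bracket_z_im: "u \<in> carrier L \<Longrightarrow> u \<otimes> z \<in> im"
  by (simp add: im_def)

lemma im_submodule: "submodule F im L"
  using submodule_image[OF rmul_hom[OF z_closed, of 1] submodule_carrier] by (simp add: im_def)

lemma decompE:
  assumes "u \<in> carrier L"
  obtains n c where "n \<in> im" "c \<in> carrier F" "u = n \<oplus> c \<odot> z"
  using decomp[OF assms] bracket_z_im by blast

text \<open>Right multiplication by any element is a scalar multiple of R, since the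
  \<open>im\<close> part of the right factor acts as zero.\<close>

lemma bracket_decomp:
  assumes "u \<in> carrier L" "n \<in> im" "c \<in> carrier F"
  shows "u \<otimes> (n \<oplus> c \<odot> z) = c \<odot> (u \<otimes> z)"
  using assms
  by (simp add: bracket_add_right bracket_smult_right im_closed bracket_im bracket_closed)

text \<open>If \<open>z\<close> were in \<open>im\<close>, right multiplication by it would vanish.
  The contradiction is drawn at exponent m+1, which is positive whatever \<open>m\<close> is, and
  carried to \<open>m\<close> by stability.\<close>

lemma z_notin_im: "z \<notin> im"
proof
  assume "z \<in> im"
  then have "u \<otimes> z = \<zero>" if "u \<in> carrier L" for u using bracket_im that by blast
  then have "rmul z (Suc m) u = \<zero>" if "u \<in> carrier L" for u using that by simp
  then show False using rmul_nonzero rmul_stable by force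
qed

text \<open>As \<open>im\<close> has codimension one, any vector outside it can replace
  \<open>z\<close> in the decomposition.\<close>

lemma decomp_via:
  assumes v: "v \<in> carrier L" "v \<notin> im" and u: "u \<in> carrier L"
  obtains n c where "n \<in> im" "c \<in> carrier F" "u = n \<oplus> c \<odot> v"
proof -
  define S where "S = {n \<oplus> c \<odot> v | n c. n \<in> im \<and> c \<in> carrier F}"
  have S: "submodule F S L"
    unfolding S_def by (rule submodule_plus_line[OF im_submodule v(1)])
  have NS: "n \<in> S" if "n \<in> im" for n
  proof -
    have "n = n \<oplus> \<zero>\<^bsub>F\<^esub> \<odot> v" using v im_closed[OF that] by simp
    then show ?thesis unfolding S_def using that by blast
  qed
  have "v = \<zero> \<oplus> \<one>\<^bsub>F\<^esub> \<odot> v" using v by simp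
  then have vS: "v \<in> S" unfolding S_def using submodule.zero_closed[OF im_submodule] by blast
  obtain n c where nc: "n \<in> im" "c \<in> carrier F" "v = n \<oplus> c \<odot> z" using decompE[OF v(1)] .
  have c0: "c \<noteq> \<zero>\<^bsub>F\<^esub>" using nc v by (auto simp: im_closed)
  have "c \<odot> z = v \<ominus> n"
    using nc im_closed by (simp add: M.minus_eq M.a_assoc M.a_comm M.r_neg2 M.r_neg1)
  then have "c \<odot> z \<in> S" using submodule_minus_closed[OF S vS NS[OF nc(1)]] by simp
  then have "z \<in> S" using smult_mem_cancel[OF S z_closed nc(2) c0] by blast
  moreover obtain n' c' where "n' \<in> im" "c' \<in> carrier F" "u = n' \<oplus> c' \<odot> z" using decompE[OF u] .
  ultimately have "u \<in> S"
    using NS submodule.m_closed[OF S] submodule.smult_closed[OF S] by blast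
  then show thesis unfolding S_def using that by blast
qed

text \<open>Some \<open>w\<close> in \<open>V\<close> has a nonzero \<open>z\<close>-coefficient, so
  right multiplication by \<open>w\<close> is R up to an invertible scalar.\<close>

lemma subalgebra_rmul:
  assumes V: "subalgebra F L V" "\<not> V \<subseteq> im" and v: "v \<in> V"
  shows "rmul z i v \<in> V"
proof (induction i)
  case 0
  show ?case using v by simp
next
  case (Suc i)
  interpret V: submodule F V L using V by (simp add: subalgebra_iff)
  obtain w where w: "w \<in> V" "w \<notin> im" using V by blast
  have wc: "w \<in> carrier L" using w V.subset by blast
  have vc: "rmul z i v \<in> carrier L" using Suc V.subset by blast
  obtain n c where nc: "n \<in> im" "c \<in> carrier F" "w = n \<oplus> c \<odot> z" using decompE[OF wc] .
  have c0: "c \<noteq> \<zero>\<^bsub>F\<^esub>" using nc w by (auto simp: im_closed)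
  have "rmul z i v \<otimes> w \<in> V" using V(1) Suc w by (simp add: subalgebra_iff)
  then have "c \<odot> (rmul z i v \<otimes> z) \<in> V" using bracket_decomp[OF vc nc(1,2)] nc by simp
  then show ?case
    using smult_mem_cancel[OF V.submodule_axioms _ nc(2) c0] vc bracket_closed by simp
qed

lemma rmul_diff_hom: "(\<lambda>u. rmul z (Suc i) u \<ominus> rmul z i u) \<in> module_hom F L L"
  by (rule module_hom_diff[OF rmul_hom rmul_hom]) (rule z_closed)+

text \<open>Write \<open>R\<close> for right multiplication by \<open>z\<close>. Since \<open>V\<close> contains some \<open>w\<close> with
  \<open>L = R(L) + F w\<close>, the claim \<open>R\<^sup>i (R - 1) L \<subseteq> V\<close> reduces to the same claim for \<open>i + 1\<close>;
  it is trivial for \<open>i = m\<close>.\<close>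

lemma subalgebra_rmul_diff:
  assumes V: "subalgebra F L V" "\<not> V \<subseteq> im" and u: "u \<in> carrier L"
  shows "u \<otimes> z \<ominus> u \<in> V"
proof -
  interpret V: submodule F V L using V by (simp add: subalgebra_iff)
  obtain w where w: "w \<in> V" "w \<notin> im" using V by blast
  have wc: "w \<in> carrier L" using w V.subset by blast
  have "\<forall>u\<in>carrier L. rmul z (Suc i) u \<ominus> rmul z i u \<in> V" if "i \<le> m" for i
    using that
  proof (induction i rule: inc_induct)
    case base
    show ?case by (simp add: rmul_stable M.minus_eq M.r_neg V.zero_closed del: rmul_Suc)
  next
    case (step i)
    show ?case
    proof
      fix u assume u: "u \<in> carrier L"
      obtain n c where nc: "n \<in> im" "c \<in> carrier F" "u = n \<oplus> c \<odot> w"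
        using decomp_via[OF wc w(2) u] .
      obtain a where a: "a \<in> carrier L" "n = a \<otimes> z" using nc(1) by (auto simp: im_def)
      let ?g = "\<lambda>u. rmul z (Suc i) u \<ominus> rmul z i u"
      have "?g u = ?g n \<oplus> c \<odot> ?g w"
        using module_hom_add[OF rmul_diff_hom[of i] im_closed[OF nc(1)], of "c \<odot> w"]
          module_hom_smult[OF rmul_diff_hom[of i] nc(2) wc] nc wc by simp
      moreover have "?g n \<in> V"
        using step.IH a by (simp add: rmul_Suc2)
      moreover have "?g w \<in> V"
        using submodule_minus_closed[OF V.submodule_axioms] subalgebra_rmul[OF V w(1)] by blast
      ultimately show "?g u \<in> V" using nc(2) by simp
    qed
  qed
  from this[of 0] u show ?thesis by simp
qed

text \<open>A right factor in \<open>im\<close> gives zero. Any other \<open>v\<close> gives c R u =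
  c u + c (R - 1) u; the first term lies in \<open>U\<close>, and the second in \<open>V\<close>
  because \<open>V\<close> is not inside \<open>im\<close>. Exchanging \<open>U\<close> and
  \<open>V\<close> covers the reversed product.\<close>

lemma bracket_in_sum:
  assumes U: "subalgebra F L U" and V: "subalgebra F L V" and u: "u \<in> U" and v: "v \<in> V"
  shows "\<exists>a\<in>U. \<exists>b\<in>V. u \<otimes> v = a \<oplus> b"
proof -
  interpret U: submodule F U L using U by (simp add: subalgebra_iff)
  interpret V: submodule F V L using V by (simp add: subalgebra_iff)
  have uc: "u \<in> carrier L" using u U.subset by blast
  have vc: "v \<in> carrier L" using v V.subset by blast
  show ?thesis
  proof (cases "v \<in> im")
    case True
    then have "u \<otimes> v = \<zero> \<oplus> \<zero>" using bracket_im uc by simp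
    then show ?thesis using U.zero_closed V.zero_closed by blast
  next
    case False
    then have "\<not> V \<subseteq> im" using v by blast
    then have d: "u \<otimes> z \<ominus> u \<in> V" using subalgebra_rmul_diff[OF V _ uc] by blast
    obtain n c where nc: "n \<in> im" "c \<in> carrier F" "v = n \<oplus> c \<odot> z" using decompE[OF vc] .
    have uz: "u \<otimes> z \<in> carrier L" using uc bracket_closed by blast
    have "u \<oplus> (u \<otimes> z \<ominus> u) = u \<otimes> z"
      using M.a_lcomm[of u "u \<otimes> z" "\<ominus> u"] uc uz by (simp add: M.minus_eq M.r_neg)
    then have "u \<otimes> v = c \<odot> (u \<oplus> (u \<otimes> z \<ominus> u))"
      using bracket_decomp[OF uc nc(1,2)] nc(3) by simp
    then have "u \<otimes> v = c \<odot> u \<oplus> c \<odot> (u \<otimes> z \<ominus> u)"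
      using nc(2) uc uz by (simp add: smult_r_distr)
    then show ?thesis using nc(2) u d by blast
  qed
qed

lemma subalgebra_weak_quasi_ideal:
  assumes U: "subalgebra F L U"
  shows "weak_quasi_ideal F L U"
proof (rule weak_quasi_idealI[OF U])
  fix V u v assume V: "subalgebra F L V" and u: "u \<in> U" and v: "v \<in> V"
  have Uc: "U \<subseteq> carrier L" and Vc: "V \<subseteq> carrier L"
    using U V by (auto simp: subalgebra_iff dest: submodule.subset)
  obtain b a where ab: "b \<in> V" "a \<in> U" "v \<otimes> u = b \<oplus> a"
    using bracket_in_sum[OF V U v u] by blast
  have "v \<otimes> u = a \<oplus> b" using ab Uc Vc M.a_comm[of b a] by auto
  with ab bracket_in_sum[OF U V u v] show "u \<otimes> v \<in> U <+>\<^bsub>L\<^esub> V \<and> v \<otimes> u \<in> U <+>\<^bsub>L\<^esub> V"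
    unfolding set_add_def' by blast
qed

section \<open>Maximal subalgebras and the Frattini quotient\<close>

lemma im_maximal: "maximal_subalgebra F L im"
  unfolding maximal_subalgebra_def
proof (intro conjI allI impI)
  have "im \<subseteq> carrier L" using im_closed by blast
  then show "subalgebra F L im"
    using im_submodule bracket_im submodule.zero_closed[OF im_submodule]
    by (auto simp: subalgebra_iff subset_eq)
  show "im \<noteq> carrier L" using z_notin_im z_closed by blast
  fix U assume U: "subalgebra F L U \<and> im \<subseteq> U"
  then interpret U: submodule F U L by (simp add: subalgebra_iff)
  show "U = im \<or> U = carrier L"
  proof (cases "U \<subseteq> im")
    case False
    then obtain w where w: "w \<in> U" "w \<notin> im" by blast
    have "u \<in> U" if u: "u \<in> carrier L" for u
    proof -
      obtain n c where "n \<in> im" "c \<in> carrier F" "u = n \<oplus> c \<odot> w"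
        using decomp_via[OF _ w(2) u] w(1) U.subset by blast
      then show ?thesis using U w(1) by blast
    qed
    then show ?thesis using U.subset by blast
  qed (use U in blast)
qed

text \<open>This is the Fitting null component of R. It absorbs right multiplications because they
  are multiples of R and so commute with R^m. It contains \<open>z\<close>, and it is proper since
  R^m is nonzero.\<close>

lemma ker_subalgebra:
  "subalgebra F L {u \<in> carrier L. rmul z m u = \<zero>}"
proof -
  have "submodule F {u \<in> carrier L. rmul z m u \<in> {\<zero>}} L"
    by (rule submodule_preimage[OF rmul_hom[OF z_closed] submodule_zero])
  moreover have "rmul z m (u \<otimes> v) = \<zero>"
    if u: "u \<in> carrier L" "rmul z m u = \<zero>" and v: "v \<in> carrier L" for u v
  proof -
    obtain n c where nc: "n \<in> im" "c \<in> carrier F" "v = n \<oplus> c \<odot> z" using decompE[OF v] .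
    then have "rmul z m (u \<otimes> v) = c \<odot> rmul z m (u \<otimes> z)"
      using u by (simp add: bracket_decomp rmul_smult bracket_closed)
    then show ?thesis using u nc by (simp add: rmul_Suc2 bracket_zero_left)
  qed
  ultimately show ?thesis by (simp add: subalgebra_iff bracket_closed)
qed

text \<open>The abelian ideal is \<open>im\<close> modulo the Frattini ideal. R acts on it as the
  identity because R - 1 maps \<open>im\<close> into the Frattini ideal.\<close>

lemma quotient_nonlie_almost_abelian:
  assumes fd: fin_dim
  shows "nonlie_almost_abelian F (quotient_algebra L (frattini_ideal F L))"
proof -
  define \<phi> where "\<phi> = frattini_ideal F L"
  have \<phi>: "leibniz_ideal F L \<phi>" and sub: "\<And>M. maximal_subalgebra F L M \<Longrightarrow> \<phi> \<subseteq> M"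
    using frattini_ideal_greatest(1,2) unfolding \<phi>_def by blast+
  have \<phi>N: "\<phi> \<subseteq> im" by (rule sub[OF im_maximal])
  let ?g = "\<lambda>u. u \<otimes> z \<ominus> u"
  have ghom: "?g \<in> module_hom F L L" using rmul_diff_hom[of 0] by simp
  have g_im: "?g n \<in> im" if "n \<in> im" for n
    using submodule_minus_closed[OF im_submodule] bracket_z_im im_closed that by blast
  have imc: "im \<subseteq> carrier L" using im_closed by blast
  have gz: "?g n \<otimes> z = ?g (n \<otimes> z)" if "n \<in> carrier L" for n
    using rmul_minus[OF z_closed _ that, of "n \<otimes> z" 1] that bracket_closed by simp
  \<comment> \<open>The image is an ideal, since R - 1 commutes with R, so it remains to see that
    every maximal subalgebra contains it. A maximal subalgebra inside \<open>im\<close> equals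
    \<open>im\<close>; any other contains (R - 1) L.\<close>
  have "?g ` im \<subseteq> \<phi>"
    unfolding \<phi>_def
  proof (rule frattini_ideal_greatest(3))
    show "leibniz_ideal F L (?g ` im)"
      unfolding leibniz_ideal_iff
    proof (intro conjI ballI)
      show sm: "submodule F (?g ` im) L" by (rule submodule_image[OF ghom im_submodule])
      fix i x assume i: "i \<in> ?g ` im" and x: "x \<in> carrier L"
      obtain n where n: "n \<in> im" "i = ?g n" using i by blast
      obtain n' c where nc: "n' \<in> im" "c \<in> carrier F" "x = n' \<oplus> c \<odot> z" using decompE[OF x] .
      have ii: "i \<in> im" using n g_im by blast
      have "i \<otimes> x = c \<odot> (i \<otimes> z)" unfolding nc(3) by (rule bracket_decomp[OF im_closed[OF ii] nc(1,2)])
      also have "i \<otimes> z = ?g (n \<otimes> z)" using gz[OF im_closed[OF n(1)]] n(2) by simp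
      finally have "i \<otimes> x = c \<odot> ?g (n \<otimes> z)" .
      moreover have "?g (n \<otimes> z) \<in> ?g ` im" using bracket_z_im[OF im_closed[OF n(1)]] by blast
      ultimately show "i \<otimes> x \<in> ?g ` im" using submodule.smult_closed[OF sm nc(2)] by simp
      show "x \<otimes> i \<in> ?g ` im"
        using bracket_im[OF x ii] submodule.zero_closed[OF sm] by simp
    qed
    show "?g ` im \<subseteq> \<Inter> {M. maximal_subalgebra F L M}"
    proof (intro subsetI InterI)
      fix d M assume d: "d \<in> ?g ` im" and "M \<in> {M. maximal_subalgebra F L M}"
      then have M: "maximal_subalgebra F L M" by simp
      show "d \<in> M"
      proof (cases "M \<subseteq> im")
        case True
        then have "im = M" using M im_maximal unfolding maximal_subalgebra_def by metis
        then show ?thesis using d g_im by blast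
      next
        case False
        have "subalgebra F L M" using M by (simp add: maximal_subalgebra_def)
        from subalgebra_rmul_diff[OF this False] show ?thesis using d imc by blast
      qed
    qed
  qed
  \<comment> \<open>In case of equality, a maximal subalgebra above the kernel of R^m would contain
    both \<open>im\<close> and \<open>z\<close>, hence all of \<open>L\<close>.\<close>
  moreover have "im \<noteq> \<phi>"
  proof
    assume eq: "im = \<phi>"
    have "{u \<in> carrier L. rmul z m u = \<zero>} \<noteq> carrier L" using rmul_nonzero by blast
    then obtain M where M: "maximal_subalgebra F L M" "{u \<in> carrier L. rmul z m u = \<zero>} \<subseteq> M"
      using subalgebra_maximal_exists[OF fd ker_subalgebra] by blast
    have zM: "z \<in> M" using M(2) rmul_z z_closed by blast
    have sM: "submodule F M L" using M(1) by (simp add: maximal_subalgebra_def subalgebra_iff)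
    have "u \<in> M" if u: "u \<in> carrier L" for u
    proof -
      obtain n c where "n \<in> im" "c \<in> carrier F" "u = n \<oplus> c \<odot> z" using decompE[OF u] .
      then show ?thesis
        using sub[OF M(1)] eq zM submodule.m_closed[OF sM] submodule.smult_closed[OF sM] by blast
    qed
    then have "M = carrier L" using submodule.subset[OF sM] by blast
    then show False using M(1) by (simp add: maximal_subalgebra_def)
  qed
  ultimately show ?thesis
    unfolding \<phi>_def[symmetric]
  proof (intro nonlie_almost_abelian_quotientI[OF \<phi> im_submodule \<phi>N])
    assume g: "?g ` im \<subseteq> \<phi>"
    show "im \<noteq> \<phi>" by fact
    show "z \<in> carrier L" by (rule z_closed)
    show "\<exists>n\<in>im. \<exists>c\<in>carrier F. u = n \<oplus> c \<odot> z" if "u \<in> carrier L" for u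
      using decompE[OF that] by blast
    have z0: "\<zero> \<in> \<phi>" using submodule.zero_closed[OF ideal_submodule[OF \<phi>]] .
    show "n \<otimes> n' \<in> \<phi>" if "n \<in> im" "n' \<in> im" for n n'
      using bracket_im[OF im_closed] that z0 by simp
    show "z \<otimes> n \<in> \<phi>" if "n \<in> im" for n
      using bracket_im that z0 by simp
    show "\<exists>i\<in>\<phi>. n \<otimes> z = i \<oplus> n" if n: "n \<in> im" for n
    proof
      show "?g n \<in> \<phi>" using g n by blast
      show "n \<otimes> z = ?g n \<oplus> n"
        using im_closed[OF n] bracket_closed by (simp add: M.minus_eq M.a_assoc M.l_neg)
    qed
  qed
qed

text \<open>\<open>C\<close> combines the nilpotent string z, R z, ... with one fixed vector
  \<open>e\<close>, and \<open>A\<close> is a complement of the line through \<open>e\<close> in the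
  space \<open>B\<close> of fixed points.\<close>

lemma cyclic_decomposition:
  assumes fd: fin_dim
  shows "\<exists>C A x k. subalgebra F L C \<and> subalgebra F L A \<and>
    carrier L = C <+>\<^bsub>L\<^esub> A \<and> C \<inter> A = {\<zero>} \<and>
    x \<in> C \<and> C = generated_subalgebra F L {x} \<and> k \<ge> 2 \<and>
    inj_on (lpow L x) {1..k} \<and>
    vectorspace.basis F (L\<lparr>carrier := C\<rparr>) (lpow L x ` {1..k}) \<and>
    lpow L x (k + 1) = lpow L x k \<and>
    abelian_subset L A \<and>
    (\<forall>a\<in>A. a \<otimes> x = a) \<and>
    (\<forall>i\<in>{1..k}. \<forall>j\<in>{2..k}. lpow L x i \<otimes> lpow L x j = \<zero>) \<and>
    (\<forall>a\<in>A. \<forall>j\<in>{2..k}. a \<otimes> lpow L x j = \<zero>) \<and>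
    (\<forall>a\<in>A. \<forall>i\<in>{1..k}. lpow L x i \<otimes> a = \<zero>)"
proof -
  define B where "B = {b \<in> carrier L. b \<otimes> z = b}"
  have Bs: "submodule F B L"
    using submodule_equalizer[OF rmul_hom[OF z_closed, of 1] rmul_hom[OF z_closed, of 0]]
    by (simp add: B_def)
  have Bc: "b \<in> carrier L" and Bz: "b \<otimes> z = b" if "b \<in> B" for b using that by (auto simp: B_def)
  have Bim: "b \<in> im" if "b \<in> B" for b using bracket_z_im[OF Bc[OF that]] Bz[OF that] by simp
  have Br: "rmul z i b = b" if "b \<in> B" for i b using Bz[OF that] by (induction i) auto
  have mB: "rmul z m u \<in> B" if "u \<in> carrier L" for u
    using rmul_stable[OF that] that by (simp add: B_def)
  \<comment> \<open>This vector becomes the stable power \<open>x^k\<close>.\<close>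
  obtain e where e: "e \<in> B" "e \<noteq> \<zero>" using rmul_nonzero mB by blast
  have ec: "e \<in> carrier L" using Bc e by blast
  \<comment> \<open>\<open>p\<close> is the exact length of the string z, R z, ..., so R^(p-1) z is
    its last nonzero term.\<close>
  define p where "p = (LEAST p. rmul z p z = \<zero>)"
  have zp: "rmul z p z = \<zero>" unfolding p_def by (rule LeastI) (rule rmul_z)
  have z0: "z \<noteq> \<zero>" using z_notin_im submodule.zero_closed[OF im_submodule] by metis
  then have p0: "0 < p" using zp by (cases p) auto
  have zp': "rmul z (p - 1) z \<noteq> \<zero>" using not_less_Least[of "p - 1" "\<lambda>p. rmul z p z = \<zero>"] p0
    by (simp add: p_def)
  define x where "x = z \<oplus> e"
  have xc: "x \<in> carrier L" using ec by (simp add: x_def)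
  \<comment> \<open>Adding \<open>e\<close> to \<open>z\<close> does not change right
    multiplication: a fixed point of R lies in \<open>im\<close>.\<close>
  have bx: "u \<otimes> x = u \<otimes> z" if "u \<in> carrier L" for u
    using that ec bracket_im[OF that Bim[OF e(1)]]
    by (simp add: x_def bracket_add_right bracket_closed)
  have rx: "rmul x i u = rmul z i u" if "u \<in> carrier L" for i u
    using that by (induction i) (simp_all add: bx)
  define v where "v = (\<lambda>i. rmul z i x)"
  have v_eq: "v i = rmul z i z \<oplus> e" for i
    using rmul_plus[OF z_closed z_closed ec] Br[OF e(1)] by (simp add: v_def x_def)
  have vc: "v i \<in> carrier L" for i using xc by (simp add: v_def)
  have vp: "v i = e" if "p \<le> i" for i
  proof -
    have "rmul z i z = rmul z (i - p) (rmul z p z)" using that rmul_add[of z "i - p" p z] by simp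
    then show ?thesis using ec by (simp add: v_eq zp rmul_zero)
  qed
  have vS: "v i \<otimes> z = v (Suc i)" for i by (simp add: v_def)
  have rv: "rmul z j (v i) = v (j + i)" for i j by (simp add: v_def rmul_add)
  have lv: "lpow L x i = v (i - 1)" for i by (simp add: lpow_rmul rx xc v_def)
  \<comment> \<open>The string accounts for p powers and the stable value \<open>e\<close> for one
    more: because of the index shift, \<open>v p\<close> is the power with exponent p+1.\<close>
  define k where "k = Suc p"
  have lv_img: "lpow L x ` {1..k} = v ` {..<k}"
  proof -
    have "(\<lambda>i. i - 1) ` {1..k} = {..<k}"
    proof
      show "{..<k} \<subseteq> (\<lambda>i. i - 1) ` {1..k}"
        by (intro subsetI image_eqI[of _ _ "Suc _"]) auto
    qed (auto simp: k_def)
    moreover have "lpow L x ` {1..k} = v ` ((\<lambda>i. i - 1) ` {1..k})"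
      unfolding image_image by (simp add: lv)
    ultimately show ?thesis by simp
  qed
  have v_im: "v (Suc i) \<in> im" for i using bracket_z_im[OF vc, of i] by (simp add: vS)
  have indep: "inj_on v {..<k} \<and> lin_indpt (v ` {..<k})"
  proof (rule lin_indpt_family[OF vc])
    fix j assume j: "j < k"
    show "v j \<notin> span (v ` {j<..<k})"
    proof (cases "j = p")
      case True
      then have "{j<..<k} = {}" by (auto simp: k_def)
      then show ?thesis using vp[of p] e True by (simp add: span_empty)
    next
      case False
      then have jp: "j < p" using j by (simp add: k_def)
      \<comment> \<open>R^(p-1-j) moves every later \<open>v i\<close> to the stable value
        \<open>e\<close> in \<open>B\<close>, but moves \<open>v j\<close> to
        \<open>v (p - 1)\<close>. Were the latter fixed by R, it would equal \<open>e\<close>, and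
        the last term of the string would vanish.\<close>
      define Q where "Q = {u \<in> carrier L. rmul z (p - 1 - j) u \<in> B}"
      have Q: "submodule F Q L"
        unfolding Q_def by (rule submodule_preimage[OF rmul_hom[OF z_closed] Bs])
      have "v ` {j<..<k} \<subseteq> Q"
        using jp e(1) vp by (auto simp: Q_def vc rv)
      then have sub: "span (v ` {j<..<k}) \<subseteq> Q" by (rule span_is_subset[OF _ Q])
      show ?thesis
      proof
        assume "v j \<in> span (v ` {j<..<k})"
        then have "v (p - 1) \<in> B" using sub jp by (auto simp: Q_def rv)
        then have "v (p - 1) \<otimes> z = v (p - 1)" by (rule Bz)
        then have "v (p - 1) = e" using vp[of p] p0 vS[of "p - 1"] by simp
        then have "rmul z (p - 1) z \<oplus> e = e" unfolding v_eq .
        then show False using zp' ec by (simp add: M.add.l_cancel_one)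
      qed
    qed
  qed
  define C where "C = span (v ` {..<k})"
  have vcs: "v ` {..<k} \<subseteq> carrier L" using vc by blast
  have Cs: "submodule F C L" unfolding C_def by (rule span_is_submodule[OF vcs])
  have vC: "v i \<in> C" for i
  proof -
    have "v i = v (min i p)" using vp[of i] vp[of p] by (simp add: min_def)
    moreover have "v (min i p) \<in> C"
      using in_own_span[OF vcs] by (auto simp: C_def k_def)
    ultimately show ?thesis by simp
  qed
  have eC: "e \<in> C" using vC[of p] vp by simp
  have Csub: "C \<subseteq> W" if "submodule F W L" "\<And>i. v i \<in> W" for W
    unfolding C_def using that by (intro span_is_subset) auto
  have Cc: "c \<in> carrier L" if "c \<in> C" for c using that submodule.subset[OF Cs] by blast
  have Ca: "subalgebra F L C"
    unfolding subalgebra_iff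
  proof (intro conjI ballI)
    fix u w assume u: "u \<in> C" and w: "w \<in> C"
    have "submodule F {u \<in> carrier L. rmul z 1 u \<in> C} L"
      by (rule submodule_preimage[OF rmul_hom[OF z_closed] Cs])
    then have "C \<subseteq> {u \<in> carrier L. rmul z 1 u \<in> C}"
      by (rule Csub) (simp add: vc vS vC)
    then have uz: "u \<otimes> z \<in> C" using u by auto
    obtain n c where nc: "n \<in> im" "c \<in> carrier F" "w = n \<oplus> c \<odot> z" using decompE[OF Cc[OF w]] .
    show "u \<otimes> w \<in> C"
      using bracket_decomp[OF Cc[OF u] nc(1,2)] nc submodule.smult_closed[OF Cs nc(2) uz] by simp
  qed (rule Cs)
  have Cgen: "C = generated_subalgebra F L {x}"
  proof
    have "x \<in> C" using vC[of 0] by (simp add: v_def)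
    then show "generated_subalgebra F L {x} \<subseteq> C" using Ca by (auto simp: generated_subalgebra_def)
    show "C \<subseteq> generated_subalgebra F L {x}"
      unfolding generated_subalgebra_def
    proof (intro Inter_greatest)
      fix U assume "U \<in> {U. subalgebra F L U \<and> {x} \<subseteq> U}"
      then have U: "subalgebra F L U" "x \<in> U" by auto
      have "v i \<in> U" for i
      proof (induction i)
        case (Suc i)
        then have "v i \<otimes> x \<in> U" using U by (simp add: subalgebra_iff)
        then show ?case by (simp add: bx vc vS)
      qed (use U in \<open>simp add: v_def\<close>)
      then show "C \<subseteq> U" using U(1) by (intro Csub) (auto simp: subalgebra_iff)
    qed
  qed
  \<comment> \<open>A maximal subspace of \<open>B\<close> avoiding \<open>e\<close> serves as the
    complement of the line through \<open>e\<close>.\<close>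
  define P where "P = (\<lambda>W. submodule F W L \<and> W \<subseteq> B \<and> e \<notin> W)"
  have P0: "P {\<zero>}" using submodule_zero submodule.zero_closed[OF Bs] e(2) by (auto simp: P_def)
  obtain A where PA: "P A" and PAmax: "\<And>W. P W \<Longrightarrow> A \<subseteq> W \<Longrightarrow> W = A"
  proof (rule maximal_submodule_exists[of P "{\<zero>}"])
    show fin_dim by (rule fd)
    show "P {\<zero>}" by (rule P0)
    show "submodule F W L" if "P W" for W using that by (simp add: P_def)
  qed (rule that)
  have A: "submodule F A L \<and> A \<subseteq> B \<and> e \<notin> A" using PA by (simp add: P_def)
  have Amax: "W = A" if "submodule F W L" "W \<subseteq> B" "e \<notin> W" "A \<subseteq> W" for W
    using PAmax[OF _ that(4)] that by (simp add: P_def)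
  interpret A: submodule F A L using A by blast
  have AB: "a \<in> B" if "a \<in> A" for a using A that by blast
  \<comment> \<open>This says B \<subseteq> A + F e. For \<open>b\<close> outside \<open>A\<close>,
    maximality puts \<open>e\<close> into A + F b, and the coefficient of \<open>b\<close> there is
    nonzero.\<close>
  have BS: "b \<in> W" if W: "submodule F W L" "A \<subseteq> W" "e \<in> W" and b: "b \<in> B" for b W
  proof (cases "b \<in> A")
    case False
    define T where "T = {a \<oplus> c \<odot> b | a c. a \<in> A \<and> c \<in> carrier F}"
    have T: "submodule F T L"
      unfolding T_def by (rule submodule_plus_line[OF A.submodule_axioms Bc[OF b]])
    have "T \<subseteq> B"
      using AB b submodule.m_closed[OF Bs] submodule.smult_closed[OF Bs] by (auto simp: T_def)
    moreover have "A \<subseteq> T"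
    proof
      fix a assume a: "a \<in> A"
      then have "a = a \<oplus> \<zero>\<^bsub>F\<^esub> \<odot> b" using Bc[OF AB] Bc[OF b] by simp
      then show "a \<in> T" unfolding T_def using a by blast
    qed
    moreover have "b = \<zero> \<oplus> \<one>\<^bsub>F\<^esub> \<odot> b" using Bc[OF b] by simp
    then have "b \<in> T" unfolding T_def using A.zero_closed by blast
    ultimately have "e \<in> T" using Amax[OF T] False by blast
    then obtain a c where ac: "a \<in> A" "c \<in> carrier F" "e = a \<oplus> c \<odot> b" unfolding T_def by blast
    have ac': "a \<in> carrier L" using Bc AB ac by blast
    have c0: "c \<noteq> \<zero>\<^bsub>F\<^esub>" using ac A Bc[OF b] ac' by auto
    have cb: "c \<odot> b = e \<ominus> a"
      using ac ac' Bc[OF b] M.a_ac by (simp add: M.minus_eq M.a_assoc M.a_comm M.r_neg2 M.r_neg1)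
    have "e \<ominus> a \<in> W" using submodule_minus_closed[OF W(1,3)] W(2) ac(1) by blast
    then have "c \<odot> b \<in> W" by (simp only: cb)
    then show ?thesis using smult_mem_cancel[OF W(1) Bc[OF b] ac(2) c0] by blast
  qed (use W in blast)
  have sum: "carrier L = C <+>\<^bsub>L\<^esub> A"
  proof -
    note S = submodule_set_add[OF Cs A.submodule_axioms]
    have "u \<in> C <+>\<^bsub>L\<^esub> A" if u: "u \<in> carrier L" for u
    proof -
      have rzC: "rmul z i z \<in> C" for i
      proof -
        have "rmul z i z = v i \<ominus> e"
          using ec by (simp add: v_eq M.minus_eq M.a_assoc M.r_neg)
        then show ?thesis using submodule_minus_closed[OF Cs vC eC] by simp
      qed
      \<comment> \<open>Decomposing the remainder repeatedly pushes it into R^i L at the cost of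
        multiples of R^i z, which lie in \<open>C\<close>. At i = m the remainder is a fixed
        point.\<close>
      have "\<exists>s\<in>C. \<exists>w\<in>carrier L. u = s \<oplus> rmul z i w" for i
      proof (induction i)
        case 0
        show ?case using u submodule.zero_closed[OF Cs] by (intro bexI[of _ \<zero>] bexI[of _ u]) auto
      next
        case (Suc i)
        then obtain s w where sw: "s \<in> C" "w \<in> carrier L" "u = s \<oplus> rmul z i w" by blast
        obtain w' c where w': "w' \<in> carrier L" "c \<in> carrier F" "w = w' \<otimes> z \<oplus> c \<odot> z"
          using decomp[OF sw(2)] by blast
        have "rmul z i w = rmul z (Suc i) w' \<oplus> c \<odot> rmul z i z"
          using w' by (simp add: rmul_plus rmul_smult rmul_Suc2 bracket_closed)
        then have "u = (s \<oplus> c \<odot> rmul z i z) \<oplus> rmul z (Suc i) w'"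
          using sw(1,3) w' Cc[OF sw(1)] by (simp add: M.a_ac bracket_closed)
        moreover have "s \<oplus> c \<odot> rmul z i z \<in> C"
          using submodule.m_closed[OF Cs sw(1)] submodule.smult_closed[OF Cs w'(2) rzC] by blast
        ultimately show ?case using w'(1) by blast
      qed
      then obtain s w where sw: "s \<in> C" "w \<in> carrier L" "u = s \<oplus> rmul z m w" by blast
      have "rmul z m w \<in> C <+>\<^bsub>L\<^esub> A"
        using BS[OF S(1,3) _ mB[OF sw(2)]] eC S(2) by blast
      then show ?thesis using sw submodule.m_closed[OF S(1)] S(2) by blast
    qed
    then show ?thesis using submodule.subset[OF S(1)] by blast
  qed
  have int: "C \<inter> A = {\<zero>}"
  proof
    show "C \<inter> A \<subseteq> {\<zero>}"
    proof
      fix c assume c: "c \<in> C \<inter> A"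
      \<comment> \<open>R^p sends every spanning vector of \<open>C\<close> to \<open>e\<close> but
        fixes \<open>A\<close>, so a common vector is a multiple of \<open>e\<close>; and
        \<open>e\<close> is not in \<open>A\<close>.\<close>
      define E where "E = {n \<oplus> d \<odot> e | n d. n \<in> {\<zero>} \<and> d \<in> carrier F}"
      have E: "submodule F E L" unfolding E_def by (rule submodule_plus_line[OF submodule_zero ec])
      have "e = \<zero> \<oplus> \<one>\<^bsub>F\<^esub> \<odot> e" using ec by simp
      then have "e \<in> E" unfolding E_def by blast
      then have "C \<subseteq> {u \<in> carrier L. rmul z p u \<in> E}"
        by (intro Csub submodule_preimage[OF rmul_hom[OF z_closed] E]) (simp add: vc rv vp)
      then have "c \<in> E" using c Br[OF AB, of c p] by auto
      then obtain d where d: "d \<in> carrier F" "c = d \<odot> e" using ec by (auto simp: E_def)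
      have "d = \<zero>\<^bsub>F\<^esub>"
        using smult_mem_cancel[OF A.submodule_axioms ec d(1)] d(2) c A by blast
      then show "c \<in> {\<zero>}" using d ec by simp
    qed
  qed (use submodule.zero_closed[OF Cs] A.zero_closed in blast)
  have Aa: "abelian_subset L A"
    using bracket_im[OF Bc[OF AB] Bim[OF AB]] by (simp add: abelian_subset_def)
  have As: "subalgebra F L A"
    using Aa A.submodule_axioms A.zero_closed by (simp add: subalgebra_iff abelian_subset_def)
  have basis: "vectorspace.basis F (L\<lparr>carrier := C\<rparr>) (lpow L x ` {1..k})"
  proof -
    interpret C: vectorspace F "L\<lparr>carrier := C\<rparr>"
      by (rule subspace_is_vs) (simp add: subspace_iff Cs)
    have sub: "v ` {..<k} \<subseteq> C" using vC by blast
    show ?thesis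
      unfolding lv_img C.basis_def span_li_not_depend[OF sub Cs] using indep sub by (simp add: C_def)
  qed
  have inj: "inj_on (lpow L x) {1..k}"
  proof (rule inj_onI)
    fix i j assume ij: "i \<in> {1..k}" "j \<in> {1..k}" "lpow L x i = lpow L x j"
    then have "i - 1 = j - 1"
      using inj_onD[OF conjunct1[OF indep], of "i - 1" "j - 1"] by (auto simp: lv)
    then show "i = j" using ij by auto
  qed
  have xC: "x \<in> C" using vC[of 0] by (simp add: v_def)
  have k2: "k \<ge> 2" using p0 by (simp add: k_def)
  have pw: "lpow L x (k + 1) = lpow L x k" by (simp add: lv vp k_def)
  have ax: "a \<otimes> x = a" if "a \<in> A" for a using bx[OF Bc[OF AB[OF that]]] Bz[OF AB[OF that]] by simp
  \<comment> \<open>Exponents from 2 on correspond to positive indices of \<open>v\<close>, which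
    are values of R.\<close>
  have lim: "lpow L x j \<in> im" if "j \<in> {2..k}" for j
    using v_im[of "j - 2"] that by (simp add: lv Suc_diff_Suc numeral_2_eq_2)
  have p1: "lpow L x i \<otimes> lpow L x j = \<zero>" if "j \<in> {2..k}" for i j
    using bracket_im[OF _ lim[OF that], of "lpow L x i"] vc by (simp add: lv)
  have p2: "a \<otimes> lpow L x j = \<zero>" if "a \<in> A" "j \<in> {2..k}" for a j
    using bracket_im[OF Bc[OF AB[OF that(1)]] lim[OF that(2)]] .
  have p3: "lpow L x i \<otimes> a = \<zero>" if "a \<in> A" for a i
    using bracket_im[OF _ Bim[OF AB[OF that]], of "lpow L x i"] vc by (simp add: lv)
  show ?thesis
    by (intro exI[of _ C] exI[of _ A] exI[of _ x] exI[of _ k] conjI ballI)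
      (rule Ca As sum int xC Cgen k2 inj basis pw Aa | (rule ax p1 p2 p3; assumption))+
qed

end

section \<open>Splittings obtained from the two explicit forms\<close>

context leibniz_algebra
begin

text \<open>With the square of \<open>y\<close> normalised to zero, right multiplication by
  \<open>y\<close> is the projection onto \<open>A\<close> along \<open>y\<close>, so exponent 1 is
  already stable.\<close>

lemma nonlie_almost_abelian_imp_split:
  assumes "nonlie_almost_abelian F L"
  shows "\<exists>y. split_leibniz F L y 1"
proof -
  obtain A y where AY: "leibniz_ideal F L A \<and> A \<noteq> {\<zero>} \<and> abelian_subset L A \<and> y \<in> carrier L \<and>
      carrier L = A <+>\<^bsub>L\<^esub> {c \<odot> y | c. c \<in> carrier F} \<and>
      (\<forall>a\<in>A. a \<otimes> y = a \<and> y \<otimes> a = \<zero>) \<and> y \<otimes> y = \<zero>"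
    using assms[unfolded nonlie_almost_abelian_iff] by (elim conjE exE) (rule that, intro conjI)
  then have A: "leibniz_ideal F L A" "A \<noteq> {\<zero>}" "abelian_subset L A"
    and y: "y \<in> carrier L"
    and car: "carrier L = A <+>\<^bsub>L\<^esub> {c \<odot> y | c. c \<in> carrier F}"
    and yy: "y \<otimes> y = \<zero>"
    by - (elim conjE, assumption)+
  have ay: "\<And>a. a \<in> A \<Longrightarrow> a \<otimes> y = a" "\<And>a. a \<in> A \<Longrightarrow> y \<otimes> a = \<zero>"
    using AY by blast+
  interpret A: submodule F A L using A(1) by (simp add: leibniz_ideal_iff)
  have Ac: "a \<in> carrier L" if "a \<in> A" for a using A.subset that by blast
  have dec: "\<exists>a\<in>A. \<exists>c\<in>carrier F. u = a \<oplus> c \<odot> y" if "u \<in> carrier L" for u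
  proof -
    have "u \<in> A <+>\<^bsub>L\<^esub> {c \<odot> y | c. c \<in> carrier F}" using that by (subst (asm) car)
    then show ?thesis unfolding set_add_def' by blast
  qed
  have uy: "u \<otimes> y \<in> A" if u: "u \<in> carrier L" for u
  proof -
    obtain a c where ac: "a \<in> A" "c \<in> carrier F" "u = a \<oplus> c \<odot> y" using dec[OF u] by blast
    then have "u \<otimes> y = a" using y by (simp add: bracket_add_left bracket_smult_left Ac ay yy)
    then show ?thesis using ac by simp
  qed
  have ua: "u \<otimes> a = \<zero>" if u: "u \<in> carrier L" and a: "a \<in> A" for u a
  proof -
    obtain b c where "b \<in> A" "c \<in> carrier F" "u = b \<oplus> c \<odot> y" using dec[OF u] by blast
    moreover from this have "b \<otimes> a = \<zero>" using A(3) a by (simp add: abelian_subset_def)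
    ultimately show ?thesis
      using y a by (simp add: bracket_add_left bracket_smult_left Ac ay)
  qed
  have "split_leibniz F L y 1"
  proof
    show "y \<in> carrier L" by (rule y)
    show "\<exists>v\<in>carrier L. \<exists>c\<in>carrier F. u = v \<otimes> y \<oplus> c \<odot> y" if "u \<in> carrier L" for u
      using dec[OF that] ay(1) Ac by metis
    show "u \<otimes> (v \<otimes> y) = \<zero>" if "u \<in> carrier L" "v \<in> carrier L" for u v
      using ua uy that by blast
    show "rmul y 1 y = \<zero>" using yy by simp
    show "rmul y (Suc 1) u = rmul y 1 u" if "u \<in> carrier L" for u
      using ay(1)[OF uy[OF that]] by simp
    obtain a where a: "a \<in> A" "a \<noteq> \<zero>" using A(2) A.zero_closed by blast
    then show "\<exists>u\<in>carrier L. rmul y 1 u \<noteq> \<zero>" using ay(1)[OF a(1)] Ac[OF a(1)] by (intro bexI[of _ a]) simp_all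
  qed
  then show ?thesis by blast
qed

text \<open>This reverses the construction x = z + e, with e = x^k. Since \<open>e\<close> gives
  zero as a right factor, \<open>z\<close> and \<open>x\<close> have the same right multiplication
  R, and R^(k-1) x = e = R^(k-1) e yields R^(k-1) z = 0.\<close>

lemma cyclic_decomposition_imp_split:
  assumes C: "subalgebra F L C" and A: "subalgebra F L A" and car: "carrier L = C <+>\<^bsub>L\<^esub> A"
    and x: "x \<in> C" and k: "k \<ge> 2"
    and basis: "vectorspace.basis F (L\<lparr>carrier := C\<rparr>) (lpow L x ` {1..k})"
    and pw: "lpow L x (k + 1) = lpow L x k"
    and AA: "abelian_subset L A" and ax: "\<And>a. a \<in> A \<Longrightarrow> a \<otimes> x = a"
    and xx: "\<And>i j. i \<in> {1..k} \<Longrightarrow> j \<in> {2..k} \<Longrightarrow> lpow L x i \<otimes> lpow L x j = \<zero>"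
    and aj: "\<And>a j. a \<in> A \<Longrightarrow> j \<in> {2..k} \<Longrightarrow> a \<otimes> lpow L x j = \<zero>"
    and ia: "\<And>a i. a \<in> A \<Longrightarrow> i \<in> {1..k} \<Longrightarrow> lpow L x i \<otimes> a = \<zero>"
  shows "split_leibniz F L (x \<ominus> lpow L x k) (k - 1)"
proof -
  have Cs: "submodule F C L" and As: "submodule F A L" using C A by (auto simp: subalgebra_iff)
  have Cc: "c \<in> carrier L" if "c \<in> C" for c using submodule.subset[OF Cs] that by blast
  have Ac: "a \<in> carrier L" if "a \<in> A" for a using submodule.subset[OF As] that by blast
  have xc: "x \<in> carrier L" using Cc x by blast
  interpret C: vectorspace F "L\<lparr>carrier := C\<rparr>"
    by (rule subspace_is_vs) (simp add: subspace_iff Cs)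
  have bs: "lpow L x ` {1..k} \<subseteq> C" using basis by (simp add: C.basis_def)
  have Cspan: "C = span (lpow L x ` {1..k})"
    using basis span_li_not_depend[OF bs Cs] by (simp add: C.basis_def)
  have li: "lin_indpt (lpow L x ` {1..k})"
    using basis span_li_not_depend[OF bs Cs] by (simp add: C.basis_def)
  have pC: "lpow L x i \<in> C" if "i \<in> {1..k}" for i using bs that by blast
  \<comment> \<open>Linear claims need checking only on the powers of \<open>x\<close> and on
    \<open>A\<close>: this is applied to the subspace on which the claim holds.\<close>
  have full: "u \<in> W" if W: "submodule F W L" "\<And>i. i \<in> {1..k} \<Longrightarrow> lpow L x i \<in> W" "A \<subseteq> W"
    and u: "u \<in> carrier L" for W u
  proof -
    have "C \<subseteq> W" unfolding Cspan using W by (intro span_is_subset) auto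
    moreover obtain c a where "c \<in> C" "a \<in> A" "u = c \<oplus> a"
      using u car unfolding set_add_def' by blast
    ultimately show ?thesis using W(3) submodule.m_closed[OF W(1)] by blast
  qed
  define e where "e = lpow L x k"
  define z where "z = x \<ominus> e"
  have e_rmul: "e = rmul x (k - 1) x" by (simp add: e_def lpow_rmul)
  have ec: "e \<in> carrier L" using xc by (simp add: e_rmul)
  have ex: "e \<otimes> x = e"
    using pw k rmul_Suc[of x "k - 1" x] by (simp add: lpow_rmul e_rmul)
  have re: "rmul x i e = e" for i using ex by (induction i) auto
  have e0: "e \<noteq> \<zero>"
  proof
    assume "e = \<zero>"
    moreover have "e \<in> lpow L x ` {1..k}" using k by (auto simp: e_def)
    ultimately show False using vs_zero_lin_dep[OF _ li] bs Cc by blast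
  qed
  define Z where "Z = {n \<in> carrier L. \<forall>u\<in>carrier L. u \<otimes> n = \<zero>}"
  have Zs: "submodule F Z L"
    by (rule submoduleI')
      (auto simp: Z_def bracket_add_right bracket_smult_right bracket_zero_right)
  have ZI: "n \<in> Z" if n: "n \<in> carrier L" and "\<And>i. i \<in> {1..k} \<Longrightarrow> lpow L x i \<otimes> n = \<zero>"
    "\<And>a. a \<in> A \<Longrightarrow> a \<otimes> n = \<zero>" for n
  proof -
    have W: "submodule F {u \<in> carrier L. rmul n 1 u \<in> {\<zero>}} L"
      by (rule submodule_preimage[OF rmul_hom[OF n] submodule_zero])
    have "u \<in> {u \<in> carrier L. rmul n 1 u \<in> {\<zero>}}" if "u \<in> carrier L" for u
      using full[OF W _ _ that] \<open>\<And>i. i \<in> {1..k} \<Longrightarrow> lpow L x i \<otimes> n = \<zero>\<close>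
        \<open>\<And>a. a \<in> A \<Longrightarrow> a \<otimes> n = \<zero>\<close> Ac Cc pC by auto
    then show ?thesis using n by (simp add: Z_def)
  qed
  have AZ: "a \<in> Z" if "a \<in> A" for a
    using ZI[OF Ac[OF that]] ia[OF that] AA that by (simp add: abelian_subset_def)
  have pZ: "lpow L x j \<in> Z" if j: "j \<in> {2..k}" for j
    using ZI[OF Cc[OF pC]] xx aj j by simp
  have Suc_pow: "lpow L x i \<otimes> x = lpow L x (Suc i)" if "i \<ge> 1" for i
    using that rmul_Suc[of x "i - 1" x] by (simp add: lpow_rmul)
  have Rx: "u \<otimes> x \<in> Z" if u: "u \<in> carrier L" for u
  proof -
    have W: "submodule F {u \<in> carrier L. rmul x 1 u \<in> Z} L"
      by (rule submodule_preimage[OF rmul_hom[OF xc] Zs])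
    have "lpow L x i \<otimes> x \<in> Z" if i: "i \<in> {1..k}" for i
    proof (cases "i = k")
      case True
      then show ?thesis using ex pZ[of k] k by (simp add: e_def)
    next
      case False
      then show ?thesis using Suc_pow[of i] pZ[of "Suc i"] i by simp
    qed
    then have "u \<in> {u \<in> carrier L. rmul x 1 u \<in> Z}"
      using AZ ax by (intro full[OF W _ _ u]) (auto simp: Cc pC Ac)
    then show ?thesis by simp
  qed
  have eZ: "e \<in> Z" using pZ[of k] k by (simp add: e_def)
  have zc: "z \<in> carrier L" using xc ec by (simp add: z_def)
  have uz: "u \<otimes> z = u \<otimes> x" if u: "u \<in> carrier L" for u
  proof -
    have "x = z \<oplus> e" using xc ec by (simp add: z_def M.minus_eq M.a_assoc M.l_neg)
    then have "u \<otimes> x = u \<otimes> z \<oplus> u \<otimes> e" using u zc ec bracket_add_right by simp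
    then show ?thesis using eZ u zc by (simp add: Z_def bracket_closed)
  qed
  have rz: "rmul z i u = rmul x i u" if "u \<in> carrier L" for i u
    using that xc by (induction i) (simp_all add: uz)
  have ri: "rmul x i x = e" if "k - 1 \<le> i" for i
    using rmul_add[of x "i - (k - 1)" "k - 1" x] that re by (simp add: e_rmul)
  have "split_leibniz F L z (k - 1)"
  proof
    show "z \<in> carrier L" by (rule zc)
    show "u \<otimes> (v \<otimes> z) = \<zero>" if "u \<in> carrier L" "v \<in> carrier L" for u v
      using Rx[OF that(2)] that by (simp add: uz Z_def)
    have "rmul x (k - 1) z = rmul x (k - 1) x \<ominus> rmul x (k - 1) e"
      unfolding z_def by (rule rmul_minus[OF xc xc ec])
    then show "rmul z (k - 1) z = \<zero>" using ec by (simp add: rz zc re ri M.minus_eq M.r_neg)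
    show "\<exists>u\<in>carrier L. rmul z (k - 1) u \<noteq> \<zero>"
      using xc e0 by (intro bexI[of _ x]) (simp_all add: rz ri)
    show "rmul z (Suc (k - 1)) u = rmul z (k - 1) u" if u: "u \<in> carrier L" for u
    proof -
      have W: "submodule F {u \<in> carrier L. rmul x (Suc (k - 1)) u = rmul x (k - 1) u} L"
        by (rule submodule_equalizer) (rule rmul_hom[OF xc])+
      have "rmul x i a = a" if "a \<in> A" for a i using ax[OF that] by (induction i) auto
      \<comment> \<open>The powers of \<open>x\<close> are iterates of R, and total exponents of at
        least k-1 all give \<open>e\<close>.\<close>
      moreover have "rmul x (Suc (k - 1)) (lpow L x i) = rmul x (k - 1) (lpow L x i)" for i
        unfolding lpow_rmul rmul_add[symmetric] by (subst (1 2) ri) auto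
      ultimately have "u \<in> {u \<in> carrier L. rmul x (Suc (k - 1)) u = rmul x (k - 1) u}"
        by (intro full[OF W _ _ u]) (auto simp: Cc pC Ac simp del: rmul_Suc)
      then show ?thesis by (simp add: rz u del: rmul_Suc)
    qed
    show "\<exists>v\<in>carrier L. \<exists>c\<in>carrier F. u = v \<otimes> z \<oplus> c \<odot> z" if u: "u \<in> carrier L" for u
    proof -
      define N where "N = (\<lambda>v. v \<otimes> z) ` carrier L"
      have N: "submodule F N L"
        using submodule_image[OF rmul_hom[OF zc, of 1] submodule_carrier] by (simp add: N_def)
      have Nc: "n \<in> carrier L" if "n \<in> N" for n using submodule.subset[OF N] that by blast
      define T where "T = {n \<oplus> c \<odot> z | n c. n \<in> N \<and> c \<in> carrier F}"
      have T: "submodule F T L" unfolding T_def by (rule submodule_plus_line[OF N zc])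
      have NT: "n \<in> T" if "n \<in> N" for n
      proof -
        have "n = n \<oplus> \<zero>\<^bsub>F\<^esub> \<odot> z" using zc Nc[OF that] by simp
        then show ?thesis unfolding T_def using that by blast
      qed
      have RN: "v \<otimes> x \<in> N" if "v \<in> carrier L" for v
        unfolding N_def using uz[OF that] that by (metis image_eqI)
      have eN: "e \<in> N" using RN[OF ec] by (simp add: ex)
      \<comment> \<open>Only the first power involves \<open>z\<close>, through x = e + z with e = R
        e. All higher powers, like \<open>A\<close>, consist of values of R.\<close>
      have "lpow L x i \<in> T" if i: "i \<in> {1..k}" for i
      proof (cases "i = 1")
        case True
        have "x = e \<oplus> \<one>\<^bsub>F\<^esub> \<odot> z"
          using xc ec M.a_lcomm[of e x "\<ominus> e"] by (simp add: z_def M.minus_eq M.r_neg)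
        then have "x \<in> T" unfolding T_def using eN by blast
        then show ?thesis using True by (simp add: lpow_rmul)
      next
        case False
        then have "1 \<le> i - 1" using i by auto
        then have "lpow L x i = lpow L x (i - 1) \<otimes> x" using Suc_pow[of "i - 1"] i by simp
        moreover have "i - 1 \<in> {1..k}" using False i by auto
        ultimately show ?thesis using NT RN[OF Cc[OF pC]] by simp
      qed
      moreover have "A \<subseteq> T" using NT RN Ac ax by (metis subsetI)
      ultimately have "u \<in> T" using full[OF T _ _ u] by blast
      then show ?thesis unfolding T_def N_def by blast
    qed
  qed
  then show ?thesis by (simp add: z_def e_def)
qed

subsection \<open>From weak quasi-ideals to the splitting\<close>

text \<open>A proper \<open>V\<close> would lie in a maximal subalgebra, and that subalgebra also
  contains the Frattini ideal.\<close>

lemma frattini_nongenerator: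
  assumes fd: fin_dim and V: "subalgebra F L V"
    and gen: "\<And>M. subalgebra F L M \<Longrightarrow> V \<subseteq> M \<Longrightarrow> frattini_ideal F L \<subseteq> M \<Longrightarrow> M = carrier L"
  shows "V = carrier L"
proof (rule ccontr)
  assume "V \<noteq> carrier L"
  then obtain M where M: "maximal_subalgebra F L M" "V \<subseteq> M"
    using subalgebra_maximal_exists[OF fd V] by blast
  moreover have "frattini_ideal F L \<subseteq> M" using frattini_ideal_greatest(2) M(1) by blast
  ultimately show False using gen unfolding maximal_subalgebra_def by blast
qed

definition right_center :: "'v set" where
  "right_center = {n \<in> carrier L. \<forall>u\<in>carrier L. u \<otimes> n = \<zero>}"

lemma right_center_submodule: "submodule F right_center L"
  by (rule submoduleI')
    (auto simp: right_center_def bracket_add_right bracket_smult_right bracket_zero_right)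

text \<open>[w,[n,u]] expands into [[w,n],u] - [[w,u],n], where \<open>n\<close> occurs as a right
  factor in both terms.\<close>

lemma right_center_bracket:
  assumes "n \<in> right_center" "u \<in> carrier L"
  shows "n \<otimes> u \<in> right_center"
proof -
  have n: "n \<in> carrier L" "\<And>w. w \<in> carrier L \<Longrightarrow> w \<otimes> n = \<zero>"
    using assms by (auto simp: right_center_def)
  then show ?thesis
    using assms(2)
    by (simp add: right_center_def leibniz_identity bracket_closed bracket_zero_left M.minus_eq)
qed

text \<open>By the Leibniz identity, [w,[u,v]] changes sign when \<open>u\<close> and
  \<open>v\<close> are exchanged.\<close>

lemma right_center_symmetric:
  assumes "u \<in> carrier L" "v \<in> carrier L"
  shows "u \<otimes> v \<oplus> v \<otimes> u \<in> right_center"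
proof -
  have "w \<otimes> (u \<otimes> v \<oplus> v \<otimes> u) = \<zero>" if w: "w \<in> carrier L" for w
  proof -
    let ?a = "(w \<otimes> u) \<otimes> v" and ?b = "(w \<otimes> v) \<otimes> u"
    have ab: "?a \<in> carrier L" "?b \<in> carrier L" using assms w bracket_closed by auto
    have "w \<otimes> (u \<otimes> v \<oplus> v \<otimes> u) = (?a \<ominus> ?b) \<oplus> (?b \<ominus> ?a)"
      using assms w by (simp add: bracket_add_right leibniz_identity bracket_closed)
    also have "\<dots> = \<zero>"
      using ab by (simp add: minus_add_minus M.minus_eq[of ?a ?a] M.r_neg)
    finally show ?thesis .
  qed
  then show ?thesis using assms by (simp add: right_center_def bracket_closed)
qed

text \<open>The symmetric sum yields only twice the square, hence nothing in characteristic
  two.\<close>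

lemma right_center_square:
  assumes "u \<in> carrier L"
  shows "u \<otimes> u \<in> right_center"
  using assms by (simp add: right_center_def leibniz_identity bracket_closed M.minus_eq M.r_neg)

text \<open>Fitting decomposition of the single vector \<open>y\<close> under right multiplication by \<open>y\<close>:
  some power of \<open>y\<close> lies in the span of the higher ones.\<close>

lemma fitting_vector:
  assumes fd: fin_dim and y: "y \<in> carrier L" and I: "submodule F I L"
    and pos: "\<And>i. rmul y (Suc i) y \<in> I"
  obtains w m where "w \<in> I" "rmul y m (y \<ominus> w) = \<zero>"
proof -
  let ?v = "\<lambda>i. rmul y i y"
  have vc: "?v i \<in> carrier L" for i using y by simp
  have "\<exists>j<Suc dim. ?v j \<in> span (?v ` {j<..<Suc dim})"
  proof (rule ccontr)
    assume "\<not> ?thesis"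
    then have li: "inj_on ?v {..<Suc dim} \<and> lin_indpt (?v ` {..<Suc dim})"
      by (intro lin_indpt_family[OF vc]) blast
    then have "card (?v ` {..<Suc dim}) = Suc dim" using card_image by fastforce
    moreover have "card (?v ` {..<Suc dim}) \<le> dim" using li vc by (intro li_le_dim(2)[OF fd]) auto
    ultimately show False by simp
  qed
  then obtain m where m: "?v m \<in> span (?v ` {m<..<Suc dim})" by blast
  \<comment> \<open>Each later iterate is R^m applied to a positive iterate, with R now right
    multiplication by \<open>y\<close>, so it lies in R^m(I). Thus R^m y = R^m w for some
    \<open>w\<close> in \<open>I\<close>.\<close>
  have img: "submodule F (rmul y m ` I) L" by (rule submodule_image[OF rmul_hom[OF y] I])
  have "?v i \<in> rmul y m ` I" if i: "i \<in> {m<..<Suc dim}" for i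
  proof -
    obtain d where d: "i = m + Suc d" using i less_imp_Suc_add[of m i] by auto
    have "?v i = rmul y m (?v (Suc d))" unfolding d by (rule rmul_add)
    then show ?thesis using pos by blast
  qed
  then have "?v ` {m<..<Suc dim} \<subseteq> rmul y m ` I" by blast
  then have "?v m \<in> rmul y m ` I" using span_is_subset[OF _ img] m by blast
  then obtain w where w: "w \<in> I" "?v m = rmul y m w" by blast
  have wc: "w \<in> carrier L" using submodule.subset[OF I] w by blast
  have "rmul y m (y \<ominus> w) = ?v m \<ominus> rmul y m w"
    by (rule rmul_minus[OF y y wc])
  also have "\<dots> = \<zero>" using w wc y by (simp add: M.minus_eq M.r_neg)
  finally show thesis using that w(1) by blast
qed

text \<open>\<open>N\<close> turns out to be the right centre and a hyperplane, and \<open>z\<close>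
  is \<open>y\<close> corrected by an element of \<phi>. The weak quasi-ideal condition enters
  through lines in \<open>N\<close>.\<close>

lemma weak_quasi_ideals_imp_split:
  assumes fd: fin_dim and wqi: "\<And>U. subalgebra F L U \<Longrightarrow> weak_quasi_ideal F L U"
    and naa: "nonlie_almost_abelian F (quotient_algebra L (frattini_ideal F L))"
  shows "\<exists>z m. split_leibniz F L z m"
proof -
  define \<phi> where "\<phi> = frattini_ideal F L"
  have \<phi>: "leibniz_ideal F L \<phi>" unfolding \<phi>_def by (rule frattini_ideal_greatest(1))
  have \<phi>s: "submodule F \<phi> L" by (rule ideal_submodule[OF \<phi>])
  have \<phi>c: "i \<in> carrier L" if "i \<in> \<phi>" for i using submodule.subset[OF \<phi>s] that by blast
  have \<phi>r: "i \<otimes> u \<in> \<phi>" if "i \<in> \<phi>" "u \<in> carrier L" for i u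
    using \<phi> that by (simp add: leibniz_ideal_iff)
  obtain N y where N: "submodule F N L" and \<phi>N: "\<phi> \<subseteq> N" and N\<phi>: "N \<noteq> \<phi>" and y: "y \<in> carrier L"
    and dec: "\<And>u. u \<in> carrier L \<Longrightarrow> \<exists>n\<in>N. \<exists>c\<in>carrier F. u = n \<oplus> c \<odot> y"
    and nn: "\<And>n n'. n \<in> N \<Longrightarrow> n' \<in> N \<Longrightarrow> n \<otimes> n' \<in> \<phi>"
    and ny: "\<And>n. n \<in> N \<Longrightarrow> \<exists>i\<in>\<phi>. n \<otimes> y = i \<oplus> n"
    and yn: "\<And>n. n \<in> N \<Longrightarrow> y \<otimes> n \<in> \<phi>" and yy: "y \<otimes> y \<in> \<phi>"
    by (rule nonlie_almost_abelian_quotientE[OF \<phi> naa[folded \<phi>_def]]) (rule that)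
  have Nc: "n \<in> carrier L" if "n \<in> N" for n using submodule.subset[OF N] that by blast
  obtain n0 where n0: "n0 \<in> N" "n0 \<notin> \<phi>" using \<phi>N N\<phi> by blast
  \<comment> \<open>Since [n,y] and \<open>n\<close> agree modulo \<phi>, membership of [n,y] passes
    back to \<open>n\<close>.\<close>
  have n_cancel: "n \<in> W" if W: "submodule F W L" "\<phi> \<subseteq> W" "n \<otimes> y \<in> W" and n: "n \<in> N" for W n
  proof -
    obtain i where i: "i \<in> \<phi>" "n \<otimes> y = i \<oplus> n" using ny[OF n] by blast
    have "n = n \<otimes> y \<ominus> i"
      unfolding i(2) using add_minus_cancel_left \<phi>c[OF i(1)] Nc[OF n] by simp
    moreover have "n \<otimes> y \<ominus> i \<in> W" using submodule_minus_closed[OF W(1,3)] i W(2) by blast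
    ultimately show ?thesis by simp
  qed
  \<comment> \<open>Modulo \<phi> the product [n,y] equals the symmetric sum [n,y] + [y,n], which is
    in the right centre.\<close>
  have n_span: "n \<in> W" if W: "submodule F W L" "\<phi> \<subseteq> W" "right_center \<subseteq> W" and n: "n \<in> N" for W n
  proof (rule n_cancel[OF W(1,2) _ n])
    have c: "n \<otimes> y \<in> carrier L" "y \<otimes> n \<in> carrier L" using Nc[OF n] y bracket_closed by auto
    have "n \<otimes> y = (n \<otimes> y \<oplus> y \<otimes> n) \<ominus> y \<otimes> n"
      using c by (simp add: add_minus_cancel_right)
    moreover have "(n \<otimes> y \<oplus> y \<otimes> n) \<ominus> y \<otimes> n \<in> W"
      using submodule_minus_closed[OF W(1)] right_center_symmetric[OF Nc[OF n] y] yn[OF n] W by blast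
    ultimately show "n \<otimes> y \<in> W" by simp
  qed
  have Zc: "k \<in> carrier L" if "k \<in> right_center" for k using that by (simp add: right_center_def)
  have Zr: "u \<otimes> k = \<zero>" if "k \<in> right_center" "u \<in> carrier L" for k u
    using that by (simp add: right_center_def)
  \<comment> \<open>The sum of the right centre and F y is a subalgebra because it contains the
    square of \<open>y\<close>. Together with \<phi> it generates \<open>L\<close>, so it is
    \<open>L\<close>.\<close>
  define V0 where "V0 = {k \<oplus> c \<odot> y | k c. k \<in> right_center \<and> c \<in> carrier F}"
  have V0s: "submodule F V0 L"
    unfolding V0_def by (rule submodule_plus_line[OF right_center_submodule y])
  have ZV0: "k \<in> V0" if "k \<in> right_center" for k
  proof -
    have "k = k \<oplus> \<zero>\<^bsub>F\<^esub> \<odot> y" using y Zc[OF that] by simp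
    then show ?thesis unfolding V0_def using that by blast
  qed
  have "V0 = carrier L"
  proof (rule frattini_nongenerator[OF fd])
    have "u \<otimes> v \<in> V0" if u: "u \<in> V0" and v: "v \<in> V0" for u v
    proof -
      obtain k c where k: "k \<in> right_center" "c \<in> carrier F" "u = k \<oplus> c \<odot> y"
        using u unfolding V0_def by blast
      obtain k' c' where k': "k' \<in> right_center" "c' \<in> carrier F" "v = k' \<oplus> c' \<odot> y"
        using v unfolding V0_def by blast
      have uc: "u \<in> carrier L" using submodule.subset[OF V0s] u by blast
      have "u \<otimes> v = c' \<odot> (u \<otimes> y)"
        using k' uc y by (simp add: bracket_add_right bracket_smult_right Zc Zr bracket_closed)
      also have "u \<otimes> y = k \<otimes> y \<oplus> c \<odot> (y \<otimes> y)"
        using k y by (simp add: bracket_add_left bracket_smult_left Zc)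
      finally have "u \<otimes> v = c' \<odot> (k \<otimes> y \<oplus> c \<odot> (y \<otimes> y))" .
      moreover have "k \<otimes> y \<in> V0" "y \<otimes> y \<in> V0"
        using ZV0 right_center_bracket[OF k(1) y] right_center_square[OF y] by auto
      ultimately show ?thesis
        using k(2) k'(2) submodule.m_closed[OF V0s] submodule.smult_closed[OF V0s] by simp
    qed
    then show "subalgebra F L V0" using V0s by (simp add: subalgebra_iff)
    fix M assume M: "subalgebra F L M" "V0 \<subseteq> M" "frattini_ideal F L \<subseteq> M"
    then have Ms: "submodule F M L" by (simp add: subalgebra_iff)
    have "y = \<zero> \<oplus> \<one>\<^bsub>F\<^esub> \<odot> y" using y by simp
    then have "y \<in> V0" unfolding V0_def using submodule.zero_closed[OF right_center_submodule] by blast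
    then have yM: "y \<in> M" using M by blast
    have ZM: "right_center \<subseteq> M" using ZV0 M(2) by blast
    have "u \<in> M" if u: "u \<in> carrier L" for u
    proof -
      obtain n c where nc: "n \<in> N" "c \<in> carrier F" "u = n \<oplus> c \<odot> y" using dec[OF u] by blast
      have "n \<in> M" using n_span[OF Ms _ ZM nc(1)] M(3) by (simp add: \<phi>_def)
      then show ?thesis
        unfolding nc(3) using submodule.m_closed[OF Ms] submodule.smult_closed[OF Ms nc(2) yM] by blast
    qed
    then show "M = carrier L" using submodule.subset[OF Ms] by blast
  qed
  then have dec0: "\<exists>k\<in>right_center. \<exists>c\<in>carrier F. u = k \<oplus> c \<odot> y" if "u \<in> carrier L" for u
    using that unfolding V0_def by blast
  \<comment> \<open>Right multiplication by \<open>y\<close> keeps \<open>n0\<close> outside \<phi>,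
    whereas [N,N] lies in \<phi>; hence \<open>y\<close> is not in \<open>N\<close>.\<close>
  have n0y: "n0 \<otimes> y \<notin> \<phi>" using n_cancel[OF \<phi>s subset_refl _ n0(1)] n0(2) by blast
  have yN: "y \<notin> N" using nn[OF n0(1)] n0y by blast
  note line_N = plus_line_coeff_zero[OF N y yN]
  \<comment> \<open>Testing k = n + c y against \<open>n0\<close>: from [n0,k] = 0 the multiple c
    [n0,y] lies in \<phi>, which forces c = 0.\<close>
  have ZN: "right_center \<subseteq> N"
  proof
    fix k assume k: "k \<in> right_center"
    obtain n c where nc: "n \<in> N" "c \<in> carrier F" "k = n \<oplus> c \<odot> y" using dec[OF Zc[OF k]] by blast
    have n0c: "n0 \<in> carrier L" using Nc n0 by blast
    have nyc: "n0 \<otimes> y \<in> carrier L" "n0 \<otimes> n \<in> carrier L" using bracket_closed n0c y Nc nc(1) by auto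
    have "n0 \<otimes> n \<oplus> c \<odot> (n0 \<otimes> y) = n0 \<otimes> k"
      using nc n0c y Nc by (simp add: bracket_add_right bracket_smult_right)
    then have z: "n0 \<otimes> n \<oplus> c \<odot> (n0 \<otimes> y) = \<zero>" using Zr[OF k n0c] by simp
    have "c \<odot> (n0 \<otimes> y) = (n0 \<otimes> n \<oplus> c \<odot> (n0 \<otimes> y)) \<ominus> n0 \<otimes> n"
      using nyc nc(2) by (simp add: add_minus_cancel_left)
    also have "\<dots> = \<zero> \<ominus> n0 \<otimes> n" by (simp only: z)
    also have "\<dots> \<in> \<phi>"
      using submodule_minus_closed[OF \<phi>s submodule.zero_closed[OF \<phi>s] nn[OF n0(1) nc(1)]] .
    finally have "c = \<zero>\<^bsub>F\<^esub>" using smult_mem_cancel[OF \<phi>s nyc(1) nc(2)] n0y by blast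
    then show "k \<in> N" using nc Nc y by simp
  qed
  have NZ: "n \<in> right_center" if n: "n \<in> N" for n
  proof -
    obtain k c where k: "k \<in> right_center" "c \<in> carrier F" "n = k \<oplus> c \<odot> y" using dec0[OF Nc[OF n]] by blast
    then have "c = \<zero>\<^bsub>F\<^esub>" using line_N[of k c] ZN n by blast
    then have "n = k" using k y by (simp add: Zc)
    then show ?thesis using k by simp
  qed
  have Nr: "u \<otimes> n = \<zero>" if "u \<in> carrier L" "n \<in> N" for u n using Zr[OF NZ] that by blast
  have pos: "rmul y (Suc i) y \<in> \<phi>" for i
    using yy \<phi>r y by (induction i) auto
  obtain w m where w: "w \<in> \<phi>" "rmul y m (y \<ominus> w) = \<zero>"
    using fitting_vector[OF fd y \<phi>s pos] .
  have wc: "w \<in> carrier L" using \<phi>c w by blast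
  define z where "z = y \<ominus> w"
  have zc: "z \<in> carrier L" using y wc by (simp add: z_def)
  have yzw: "y = w \<oplus> z" using y wc by (simp add: z_def add_minus_cancel)
  \<comment> \<open>The correction \<open>w\<close> lies in \<phi>, hence in the right centre, so
    \<open>y\<close> and \<open>z\<close> have the same right multiplication R.\<close>
  have uz: "u \<otimes> z = u \<otimes> y" if u: "u \<in> carrier L" for u
  proof -
    have "u \<otimes> y = u \<otimes> w \<oplus> u \<otimes> z" using u zc wc bracket_add_right by (simp add: yzw)
    then show ?thesis using Nr[OF u] w(1) \<phi>N u zc by (auto simp: bracket_closed)
  qed
  have rz: "rmul z i u = rmul y i u" if "u \<in> carrier L" for i u
    using that y by (induction i) (simp_all add: uz)
  have zm: "rmul z m z = \<zero>" using w(2) zc by (simp add: rz) (simp add: z_def)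
  have zN: "z \<notin> N"
  proof
    assume "z \<in> N"
    then have "y \<in> N" unfolding yzw using submodule.m_closed[OF N] w(1) \<phi>N by blast
    then show False using yN by blast
  qed
  have decz: "\<exists>n\<in>N. \<exists>c\<in>carrier F. u = n \<oplus> c \<odot> z" if u: "u \<in> carrier L" for u
  proof -
    obtain n c where nc: "n \<in> N" "c \<in> carrier F" "u = n \<oplus> c \<odot> y" using dec[OF u] by blast
    then have "u = (n \<oplus> c \<odot> w) \<oplus> c \<odot> z"
      using wc zc Nc by (simp add: yzw smult_r_distr M.a_assoc)
    moreover have "n \<oplus> c \<odot> w \<in> N"
      using submodule.m_closed[OF N nc(1)] submodule.smult_closed[OF N nc(2)] w(1) \<phi>N by blast
    ultimately show ?thesis using nc(2) by blast
  qed
  note line_zN = plus_line_coeff_zero[OF N zc zN]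
  have uyN: "u \<otimes> z \<in> N" if u: "u \<in> carrier L" for u
  proof -
    obtain n c where nc: "n \<in> N" "c \<in> carrier F" "u = n \<oplus> c \<odot> y" using dec[OF u] by blast
    have e: "u \<otimes> y = n \<otimes> y \<oplus> c \<odot> (y \<otimes> y)"
      unfolding nc(3) using nc(1,2) y by (simp add: bracket_add_left bracket_smult_left Nc)
    obtain i where i: "i \<in> \<phi>" "n \<otimes> y = i \<oplus> n" using ny[OF nc(1)] by blast
    have "n \<otimes> y \<in> N" unfolding i(2) using submodule.m_closed[OF N _ nc(1)] i(1) \<phi>N by blast
    then have "n \<otimes> y \<oplus> c \<odot> (y \<otimes> y) \<in> N"
      using submodule.m_closed[OF N] submodule.smult_closed[OF N nc(2)] yy \<phi>N by blast
    then show ?thesis using uz[OF u] e by simp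
  qed
  \<comment> \<open>\<open>V\<close> is the subalgebra generated by \<open>z\<close>; only its
    spanning set is used below.\<close>
  define V where "V = span (range (\<lambda>i. rmul z i z))"
  have rng: "range (\<lambda>i. rmul z i z) \<subseteq> carrier L" using zc by auto
  have Vs: "submodule F V L" unfolding V_def by (rule span_is_submodule[OF rng])
  have VI: "V \<subseteq> W" if "submodule F W L" "\<And>i. rmul z i z \<in> W" for W
    unfolding V_def using that by (intro span_is_subset) auto
  have zV: "rmul z i z \<in> V" for i unfolding V_def using in_own_span[OF rng] by blast
  have V: "subalgebra F L V"
    unfolding subalgebra_iff
  proof (intro conjI ballI)
    fix u v assume u: "u \<in> V" and v: "v \<in> V"
    have uc: "u \<in> carrier L" "v \<in> carrier L" using submodule.subset[OF Vs] u v by auto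
    obtain n c where nc: "n \<in> N" "c \<in> carrier F" "v = n \<oplus> c \<odot> z" using decz[OF uc(2)] by blast
    have "rmul z 1 (rmul z i z) \<in> V" for i using zV[of "Suc i"] by simp
    then have "V \<subseteq> {u \<in> carrier L. rmul z 1 u \<in> V}"
      using zc by (intro VI submodule_preimage[OF rmul_hom[OF zc] Vs]) blast
    then have "u \<otimes> z \<in> V" using u by auto
    moreover have "u \<otimes> v = c \<odot> (u \<otimes> z)"
      unfolding nc(3) using nc(1,2) uc zc
      by (simp add: bracket_add_right bracket_smult_right Nc Nr bracket_closed)
    ultimately show "u \<otimes> v \<in> V" using submodule.smult_closed[OF Vs nc(2)] by simp
  qed (rule Vs)
  \<comment> \<open>\<open>V\<close> lies in W + F z and \<open>z\<close> is outside
    \<open>N\<close>, so intersecting with \<open>N\<close> removes the \<open>z\<close>-term. This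
    is applied with \<phi> and with R(L) in place of \<open>W\<close>.\<close>
  have V_line: "v \<in> W" if W: "submodule F W L" "W \<subseteq> N" "\<And>i. rmul z (Suc i) z \<in> W"
    and v: "v \<in> V" "v \<in> N" for W v
  proof -
    define T where "T = {r \<oplus> c \<odot> z | r c. r \<in> W \<and> c \<in> carrier F}"
    have T: "submodule F T L" unfolding T_def by (rule submodule_plus_line[OF W(1) zc])
    have "rmul z i z \<in> T" for i
    proof (cases i)
      case 0
      have "z = \<zero> \<oplus> \<one>\<^bsub>F\<^esub> \<odot> z" using zc by simp
      then have "z \<in> T" unfolding T_def using submodule.zero_closed[OF W(1)] by blast
      then show ?thesis using 0 by simp
    next
      case (Suc j)
      have "rmul z (Suc j) z = rmul z (Suc j) z \<oplus> \<zero>\<^bsub>F\<^esub> \<odot> z" using zc by (simp add: bracket_closed)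
      then show ?thesis unfolding T_def Suc using W(3) by blast
    qed
    then have "V \<subseteq> T" by (rule VI[OF T])
    then obtain r c where r: "r \<in> W" "c \<in> carrier F" "v = r \<oplus> c \<odot> z" using v unfolding T_def by blast
    have rN: "r \<in> N" using r W(2) by blast
    have "c = \<zero>\<^bsub>F\<^esub>" using line_zN[OF rN r(2)] v(2) r(3) by simp
    then have "v = r" using r zc Nc[OF rN] by simp
    then show ?thesis using r by simp
  qed
  have zz: "z \<otimes> z \<in> \<phi>"
  proof -
    have "z \<otimes> y = y \<otimes> y \<ominus> w \<otimes> y"
      using rmul_minus[OF y y wc, of 1] by (simp add: z_def)
    then show ?thesis using uz[OF zc] submodule_minus_closed[OF \<phi>s yy \<phi>r[OF w(1) y]] by simp
  qed
  have V\<phi>: "v \<in> \<phi>" if "v \<in> V" "v \<in> N" for v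
  proof (rule V_line[OF \<phi>s \<phi>N _ that])
    show "rmul z (Suc i) z \<in> \<phi>" for i using zz \<phi>r zc by (induction i) auto
  qed
  let ?g = "\<lambda>u. u \<otimes> z \<ominus> u"
  have ghom: "?g \<in> module_hom F L L"
    using module_hom_diff[OF rmul_hom[OF zc, of 1] rmul_hom[OF zc, of 0]] by simp
  have nz\<phi>: "\<exists>i\<in>\<phi>. n \<otimes> z = i \<oplus> n" if "n \<in> N" for n using ny[OF that] uz[OF Nc[OF that]] by simp
  \<comment> \<open>The weak quasi-ideal condition gives [n,z] = c n + b with \<open>b\<close> in
    \<open>V\<close>. Here \<open>b\<close> lies in both \<open>V\<close> and \<open>N\<close>,
    hence in \<phi>, and [n,z] agrees with \<open>n\<close> modulo \<phi>. So (1 - c) n lies in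
    \<phi> and c = 1.\<close>
  have g1: "?g n \<in> V" if n: "n \<in> N" "n \<notin> \<phi>" for n
  proof -
    have nc: "n \<in> carrier L" using Nc n by blast
    define U where "U = {k \<oplus> c \<odot> n | k c. k \<in> {\<zero>} \<and> c \<in> carrier F}"
    have Us: "submodule F U L" unfolding U_def by (rule submodule_plus_line[OF submodule_zero nc])
    have UN: "U \<subseteq> N" unfolding U_def using n submodule.smult_closed[OF N] Nc by auto
    have U: "subalgebra F L U"
      unfolding subalgebra_iff using Us UN Nr Nc submodule.zero_closed[OF Us] by (auto simp: subset_eq)
    have "n = \<zero> \<oplus> \<one>\<^bsub>F\<^esub> \<odot> n" using nc by simp
    then have nU: "n \<in> U" unfolding U_def by blast
    have "z \<in> V" using zV[of 0] by simp
    then obtain a b where ab: "a \<in> U" "b \<in> V" "n \<otimes> z = a \<oplus> b"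
      using weak_quasi_idealD[OF wqi[OF U] V nU] by blast
    obtain c where c: "c \<in> carrier F" "a = c \<odot> n" using ab(1) nc unfolding U_def by auto
    have bc: "b \<in> carrier L" using submodule.subset[OF Vs] ab by blast
    have ac: "a \<in> carrier L" using c nc by simp
    have "b = n \<otimes> z \<ominus> a" unfolding ab(3) using ac bc by (simp add: add_minus_cancel_left)
    then have bN: "b \<in> N" using submodule_minus_closed[OF N uyN[OF nc]] UN ab(1) by auto
    have b\<phi>: "b \<in> \<phi>" using V\<phi>[OF ab(2) bN] .
    obtain i where i: "i \<in> \<phi>" "n \<otimes> z = i \<oplus> n" using nz\<phi>[OF n(1)] by blast
    have ic: "i \<in> carrier L" using \<phi>c i by blast
    have h: "i \<oplus> n = c \<odot> n \<oplus> b" using i ab c by simp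
    have eq: "b \<ominus> i = n \<ominus> c \<odot> n"
    proof -
      have "b \<ominus> i = (c \<odot> n \<oplus> b) \<ominus> c \<odot> n \<ominus> i"
        using bc c nc by (simp add: add_minus_cancel_left)
      also have "\<dots> = (i \<oplus> n) \<ominus> c \<odot> n \<ominus> i" by (simp only: h)
      also have "\<dots> = n \<ominus> c \<odot> n"
        using ic c nc M.a_comm[of i n] M.a_comm[of i "\<ominus> (c \<odot> n)"]
        by (simp add: M.minus_eq M.a_assoc M.l_neg M.r_neg)
      finally show ?thesis .
    qed
    have "(\<one>\<^bsub>F\<^esub> \<ominus>\<^bsub>F\<^esub> c) \<odot> n = n \<ominus> c \<odot> n"
      using c nc by (simp add: R.minus_eq M.minus_eq smult_l_distr smult_l_minus)
    also have "\<dots> \<in> \<phi>" unfolding eq[symmetric] by (rule submodule_minus_closed[OF \<phi>s b\<phi> i(1)])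
    finally have c1: "\<one>\<^bsub>F\<^esub> \<ominus>\<^bsub>F\<^esub> c = \<zero>\<^bsub>F\<^esub>" using smult_mem_cancel[OF \<phi>s nc] c n(2) by blast
    then have "c = \<one>\<^bsub>F\<^esub>" using c(1) by simp
    then have "n \<otimes> z = n \<oplus> b" using ab c nc by simp
    then have "?g n = b" using nc bc by (simp add: add_minus_cancel_left)
    then show ?thesis using ab by simp
  qed
  \<comment> \<open>For \<open>n\<close> in \<phi> the coefficient cannot be determined this way.
    Translation by \<open>n0\<close> leaves \<phi>, and linearity recovers the claim.\<close>
  have g: "?g n \<in> V" if n: "n \<in> N" for n
  proof (cases "n \<in> \<phi>")
    case True
    have nc: "n \<in> carrier L" "n0 \<in> carrier L" using Nc n n0 by auto
    have sN: "n0 \<oplus> n \<in> N" using submodule.m_closed[OF N n0(1) n] .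
    have "n0 \<oplus> n \<notin> \<phi>"
    proof
      assume "n0 \<oplus> n \<in> \<phi>"
      then have "(n0 \<oplus> n) \<ominus> n \<in> \<phi>" using submodule_minus_closed[OF \<phi>s _ True] by blast
      moreover have "(n0 \<oplus> n) \<ominus> n = n0" using nc by (simp add: add_minus_cancel_right)
      ultimately show False using n0 by simp
    qed
    then have "?g (n0 \<oplus> n) \<in> V" by (rule g1[OF sN])
    then have "?g n0 \<oplus> ?g n \<in> V" using module_hom_add[OF ghom nc(2,1)] by simp
    then have "(?g n0 \<oplus> ?g n) \<ominus> ?g n0 \<in> V" using submodule_minus_closed[OF Vs _ g1[OF n0]] by blast
    moreover have "?g n0 \<in> carrier L" "?g n \<in> carrier L"
      using module_hom_closed[OF ghom] nc by auto
    then have "(?g n0 \<oplus> ?g n) \<ominus> ?g n0 = ?g n" by (rule add_minus_cancel_left)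
    ultimately show ?thesis by simp
  qed (use g1 n in blast)
  have "split_leibniz F L z m"
  proof
    show "z \<in> carrier L" by (rule zc)
    show "u \<otimes> (v \<otimes> z) = \<zero>" if "u \<in> carrier L" "v \<in> carrier L" for u v
      using Nr uyN that by blast
    show "rmul z m z = \<zero>" by (rule zm)
    show "\<exists>v\<in>carrier L. \<exists>c\<in>carrier F. u = v \<otimes> z \<oplus> c \<odot> z" if u: "u \<in> carrier L" for u
    proof -
      obtain n c where nc: "n \<in> N" "c \<in> carrier F" "u = n \<oplus> c \<odot> z" using decz[OF u] by blast
      have ncl: "n \<in> carrier L" using Nc nc by blast
      define R where "R = (\<lambda>v. v \<otimes> z) ` carrier L"
      have R: "submodule F R L"
        using submodule_image[OF rmul_hom[OF zc, of 1] submodule_carrier] by (simp add: R_def)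
      have RN: "R \<subseteq> N" using uyN by (auto simp: R_def)
      have gN: "?g n \<in> N" using submodule_minus_closed[OF N uyN[OF ncl] nc(1)] .
      \<comment> \<open>With this, n = R n - (R - 1) n is a difference of two elements of
        R(L).\<close>
      have gR: "?g n \<in> R"
      proof (rule V_line[OF R RN _ g[OF nc(1)] gN])
        show "rmul z (Suc i) z \<in> R" for i using zc by (simp add: R_def)
      qed
      have "n \<otimes> z \<in> R" using ncl by (simp add: R_def)
      then have "n \<otimes> z \<ominus> ?g n \<in> R" using submodule_minus_closed[OF R _ gR] by blast
      moreover have "n \<otimes> z \<ominus> ?g n = n"
        using ncl zc by (simp add: minus_minus_cancel bracket_closed)
      ultimately show ?thesis using nc unfolding R_def by auto
    qed
    \<comment> \<open>R^m commutes with the iterates of R that produce \<open>V\<close> from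
      \<open>z\<close>.\<close>
    have Vm: "rmul z m v = \<zero>" if "v \<in> V" for v
    proof -
      have "V \<subseteq> {u \<in> carrier L. rmul z m u \<in> {\<zero>}}"
      proof (rule VI[OF submodule_preimage[OF rmul_hom[OF zc] submodule_zero]])
        show "rmul z i z \<in> {u \<in> carrier L. rmul z m u \<in> {\<zero>}}" for i
          using rmul_commute[of z m i z] zc zm by (simp add: rmul_zero)
      qed
      then show ?thesis using that by auto
    qed
    show "rmul z (Suc m) u = rmul z m u" if u: "u \<in> carrier L" for u
    proof -
      let ?E = "{u \<in> carrier L. rmul z (Suc m) u = rmul z m u}"
      have E: "submodule F ?E L" by (rule submodule_equalizer) (rule rmul_hom[OF zc])+
      obtain n c where nc: "n \<in> N" "c \<in> carrier F" "u = n \<oplus> c \<odot> z" using decz[OF u] by blast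
      have ncl: "n \<in> carrier L" using Nc nc by blast
      have c: "?g n \<in> carrier L" using ncl zc bracket_closed by auto
      have "n \<otimes> z = ?g n \<oplus> n"
        using ncl zc by (simp add: minus_add_cancel bracket_closed)
      then have "rmul z m (n \<otimes> z) = rmul z m (?g n) \<oplus> rmul z m n"
        using rmul_plus[OF zc c ncl] by simp
      then have "n \<in> ?E" using Vm[OF g[OF nc(1)]] ncl zc by (simp add: rmul_Suc2)
      moreover have "z \<in> ?E" using zm zc by (simp add: bracket_zero_left)
      ultimately have "u \<in> ?E"
        unfolding nc(3) using submodule.m_closed[OF E] submodule.smult_closed[OF E nc(2)] by blast
      then show ?thesis by blast
    qed
    show "\<exists>u\<in>carrier L. rmul z m u \<noteq> \<zero>"
    proof (intro bexI[of _ n0] notI)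
      show n0c: "n0 \<in> carrier L" using Nc n0 by blast
      \<comment> \<open>Modulo \<phi>, R is the identity on \<open>N\<close>, so no iterate of
        \<open>n0\<close> can fall into \<phi>, let alone vanish.\<close>
      have "rmul z i n0 \<in> N \<and> rmul z i n0 \<notin> \<phi>" for i
      proof (induction i)
        case (Suc i)
        then have r: "rmul z i n0 \<in> N" "rmul z i n0 \<notin> \<phi>" by auto
        have "rmul z i n0 \<otimes> y \<notin> \<phi>" using n_cancel[OF \<phi>s subset_refl _ r(1)] r(2) by blast
        then show ?case using uyN[OF Nc[OF r(1)]] uz[OF Nc[OF r(1)]] by simp
      qed (use n0 in simp)
      moreover assume "rmul z m n0 = \<zero>"
      ultimately show False using submodule.zero_closed[OF \<phi>s] by metis
    qed
  qed
  then show ?thesis by blast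
qed

end

theorem theorem3p5:
  fixes F :: "('f, 'r) ring_scheme" and L :: "('f, 'v, 'm) module_scheme" (structure)
  assumes "leibniz_algebra F L" and "vectorspace.fin_dim F L"
  shows "((\<forall>U. subalgebra F L U \<longrightarrow> weak_quasi_ideal F L U) \<and>
          nonlie_almost_abelian F (quotient_algebra L (frattini_ideal F L)))
     \<longleftrightarrow>
         (nonlie_almost_abelian F L \<or>
          (\<exists>C A x k.
             \<comment> \<open>\<open>L\<close> is the vector space direct sum of the subalgebras \<open>C\<close> and \<open>A\<close>\<close>
             subalgebra F L C \<and> subalgebra F L A \<and>
             carrier L = C <+> A \<and> C \<inter> A = {\<zero>} \<and>
             \<comment> \<open>\<open>C\<close> is cyclic with basis \<open>x, \<dots>, x^k\<close> and \<open>x^(k+1) = x^k\<close>\<close>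
             x \<in> C \<and> C = generated_subalgebra F L {x} \<and> k \<ge> 2 \<and>
             inj_on (lpow L x) {1..k} \<and>
             vectorspace.basis F (L\<lparr>carrier := C\<rparr>) (lpow L x ` {1..k}) \<and>
             lpow L x (k + 1) = lpow L x k \<and>
             abelian_subset L A \<and>
             (\<forall>a\<in>A. a \<otimes> x = a) \<and>
             \<comment> \<open>all other products are zero\<close>
             (\<forall>i\<in>{1..k}. \<forall>j\<in>{2..k}. lpow L x i \<otimes> lpow L x j = \<zero>) \<and>
             (\<forall>a\<in>A. \<forall>j\<in>{2..k}. a \<otimes> lpow L x j = \<zero>) \<and>
             (\<forall>a\<in>A. \<forall>i\<in>{1..k}. lpow L x i \<otimes> a = \<zero>)))"
  (is "?lhs \<longleftrightarrow> ?i \<or> ?ii")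
proof -
  interpret leibniz_algebra F L by fact
  have fd: fin_dim by fact
  have split: "?lhs \<longleftrightarrow> (\<exists>z m. split_leibniz F L z m)"
  proof
    assume ?lhs
    then show "\<exists>z m. split_leibniz F L z m" using weak_quasi_ideals_imp_split[OF fd] by blast
  next
    assume "\<exists>z m. split_leibniz F L z m"
    then obtain z m where S: "split_leibniz F L z m" by blast
    show ?lhs
      using split_leibniz.subalgebra_weak_quasi_ideal[OF S]
        split_leibniz.quotient_nonlie_almost_abelian[OF S fd] by blast
  qed
  show ?thesis
    unfolding split
  proof
    assume "\<exists>z m. split_leibniz F L z m"
    then obtain z m where "split_leibniz F L z m" by blast
    \<comment> \<open>The decomposition exists for every splitting; for m = 1 the construction
      yields k = 2.\<close>
    from split_leibniz.cyclic_decomposition[OF this fd] show "?i \<or> ?ii" by (rule disjI2)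
  next
    assume "?i \<or> ?ii"
    then show "\<exists>z m. split_leibniz F L z m"
    proof
      assume ?i
      then show ?thesis using nonlie_almost_abelian_imp_split by blast
    next
      assume ?ii
      then show ?thesis
      proof (elim exE conjE)
        fix C A x k
        assume "subalgebra F L C" "subalgebra F L A" "carrier L = C <+> A" "x \<in> C" "2 \<le> k"
          "vectorspace.basis F (L\<lparr>carrier := C\<rparr>) (lpow L x ` {1..k})"
          "lpow L x (k + 1) = lpow L x k" "abelian_subset L A" and ax: "\<forall>a\<in>A. a \<otimes> x = a"
          and xx: "\<forall>i\<in>{1..k}. \<forall>j\<in>{2..k}. lpow L x i \<otimes> lpow L x j = \<zero>"
          and aj: "\<forall>a\<in>A. \<forall>j\<in>{2..k}. a \<otimes> lpow L x j = \<zero>"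
          and ia: "\<forall>a\<in>A. \<forall>i\<in>{1..k}. lpow L x i \<otimes> a = \<zero>"
        then have "split_leibniz F L (x \<ominus> lpow L x k) (k - 1)"
          by (intro cyclic_decomposition_imp_split) (assumption | blast)+
        then show ?thesis by blast
      qed
    qed
  qed
qed

end
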